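(* Let $\mathcal B$ be a unital Banach algebra, $U\subseteq\mathbb C$ an open set, and $\mathcal B_U:=\{a\in\mathcal B:\sigma(a)\subseteq U\}$. If $f:U\to\mathbb C$ is holomorphic, then the map $f_{\mathcal B}:\mathcal B_U\to\mathcal B$, $a\mapsto f(a)$, induced by the holomorphic functional calculus, is holomorphic. Furthermore, if $k\in\mathbb N$, $a\in\mathcal B_U$, and $\Gamma$ is a cycle surrounding $\sigma(a)$ in $U$, then $$\partial_{b_k}\cdots\partial_{b_1}f_{\mathcal B}(a)=\frac1{2\pi i}\sum_{\pi\in S_k}\int_\Gamma f(z)\,(z-a)^{-1}b_{\pi(1)}\cdots(z-a)^{-1}b_{\pi(k)}\,(z-a)^{-1}\,dz$$ for all $b_1,\ldots,b_k\in\mathcal B$, where $S_k$ is the symmetric group on $k$ letters.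
   Context: $\sigma(a)$ is the spectrum of $a$ in $\mathcal B$; the set $\mathcal B_U$ is open in $\mathcal B$. A cycle in $U$ is a finite collection of closed, piecewise $C^1$ curves in $U$. A cycle $\Gamma$ in $U$ surrounds $S\subseteq U$ in $U$ if its winding number $W_\Gamma(z)$ is $0$ for all $z\in\mathbb C\setminus U$ and is $1$ for all $z\in S$. For $a\in\mathcal B_U$ and $f$ holomorphic on $U$, the (Dunford--Riesz) holomorphic functional calculus is $f(a)=\frac1{2\pi i}\int_\Gamma f(z)(z-a)^{-1}\,dz$ for any cycle $\Gamma$ surrounding $\sigma(a)$ in $U$. A map from an open subset of a complex Banach space to a complex Banach space is holomorphic if it is complex Fréchet differentiable. $\partial_b$ denotes the directional derivative in direction $b$: $\partial_{b_k}\cdots\partial_{b_1}F(a)=\frac{d}{ds_k}\big|_{s_k=0}\cdots\frac{d}{ds_1}\big|_{s_1=0}F(a+s_1b_1+\cdots+s_kb_k)$. *)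

theory Defs
  imports "HOL-Complex_Analysis.Complex_Analysis" "HOL-Combinatorics.Permutations"
begin

(* The libraries used here only provide real normed spaces and algebras; complex ones are
   obtained by adding a complex scalar multiplication that extends the real one. *)

class complex_normed_vector = real_normed_vector +
  fixes scaleC :: "complex \<Rightarrow> 'a \<Rightarrow> 'a" (infixr \<open>*\<^sub>C\<close> 75)
  assumes scaleC_add_right: "c *\<^sub>C (x + y) = c *\<^sub>C x + c *\<^sub>C y"
    and scaleC_add_left: "(c + d) *\<^sub>C x = c *\<^sub>C x + d *\<^sub>C x"
    and scaleC_scaleC: "c *\<^sub>C (d *\<^sub>C x) = (c * d) *\<^sub>C x"
    and scaleC_of_real: "complex_of_real r *\<^sub>C x = r *\<^sub>R x"
    and norm_scaleC: "norm (c *\<^sub>C x) = cmod c * norm x"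

class complex_banach = complex_normed_vector + banach

(* The normalisation norm 1 = 1 is deliberately not required. *)
class complex_banach_algebra_1 = complex_banach + real_algebra_1 + real_normed_algebra +
  assumes mult_scaleC_left: "(c *\<^sub>C x) * y = c *\<^sub>C (x * y)"
    and mult_scaleC_right: "x * (c *\<^sub>C y) = c *\<^sub>C (x * y)"

definition is_inverse_of :: "'a::monoid_mult \<Rightarrow> 'a \<Rightarrow> bool" where
  "is_inverse_of y x \<longleftrightarrow> x * y = 1 \<and> y * x = 1"

definition spectrum :: "'a::complex_banach_algebra_1 \<Rightarrow> complex set" where
  "spectrum a = {z. \<not> (\<exists>y. is_inverse_of y (z *\<^sub>C 1 - a))}"

(* Only meaningful for z outside the spectrum of a. *)
definition resolvent :: "'a::complex_banach_algebra_1 \<Rightarrow> complex \<Rightarrow> 'a" where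
  "resolvent a z = (THE y. is_inverse_of y (z *\<^sub>C 1 - a))"

definition spectrum_in :: "complex set \<Rightarrow> 'a::complex_banach_algebra_1 set" where
  "spectrum_in U = {a. spectrum a \<subseteq> U}"

(* A cycle is a list of curves, so that a curve may occur with multiplicity. *)
definition cycle_in :: "(real \<Rightarrow> complex) list \<Rightarrow> complex set \<Rightarrow> bool" where
  "cycle_in \<Gamma> U \<longleftrightarrow>
     (\<forall>\<gamma>\<in>set \<Gamma>. valid_path \<gamma> \<and> pathfinish \<gamma> = pathstart \<gamma> \<and> path_image \<gamma> \<subseteq> U)"

definition cycle_winding_number :: "(real \<Rightarrow> complex) list \<Rightarrow> complex \<Rightarrow> complex" where
  "cycle_winding_number \<Gamma> z = (\<Sum>\<gamma>\<leftarrow>\<Gamma>. winding_number \<gamma> z)"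

(* The curves must avoid S explicitly: winding_number is total, and its value at a point
   lying on the curve is meaningless. *)
definition surrounds_in :: "(real \<Rightarrow> complex) list \<Rightarrow> complex set \<Rightarrow> complex set \<Rightarrow> bool" where
  "surrounds_in \<Gamma> S U \<longleftrightarrow>
     cycle_in \<Gamma> U \<and> S \<subseteq> U \<and> (\<forall>\<gamma>\<in>set \<Gamma>. path_image \<gamma> \<inter> S = {}) \<and>
     (\<forall>z. z \<notin> U \<longrightarrow> cycle_winding_number \<Gamma> z = 0) \<and>
     (\<forall>z\<in>S. cycle_winding_number \<Gamma> z = 1)"

(* Vector-valued analogue of contour_integral, with the same parametrised integrand. *)
definition cycle_integral ::
    "(real \<Rightarrow> complex) list \<Rightarrow> (complex \<Rightarrow> 'a::complex_banach) \<Rightarrow> 'a" where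
  "cycle_integral \<Gamma> g =
     (\<Sum>\<gamma>\<leftarrow>\<Gamma>. integral {0..1} (\<lambda>t. vector_derivative \<gamma> (at t within {0..1}) *\<^sub>C g (\<gamma> t)))"

(* The common value of the Dunford-Riesz integrals over all cycles surrounding the spectrum. *)
definition holomorphic_calculus ::
    "complex set \<Rightarrow> (complex \<Rightarrow> complex) \<Rightarrow> 'a::complex_banach_algebra_1 \<Rightarrow> 'a" where
  "holomorphic_calculus U f a =
     (THE v. \<forall>\<Gamma>. surrounds_in \<Gamma> (spectrum a) U \<longrightarrow>
        v = (1 / (2 * of_real pi * \<i>)) *\<^sub>C cycle_integral \<Gamma> (\<lambda>z. f z *\<^sub>C resolvent a z))"

(* has_derivative provides a bounded real-linear derivative; homogeneity over the complex
   numbers makes it the complex Frechet derivative. *)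
definition holomorphic_map_on ::
    "('a::complex_banach \<Rightarrow> 'b::complex_banach) \<Rightarrow> 'a set \<Rightarrow> bool" where
  "holomorphic_map_on F S \<longleftrightarrow>
     open S \<and> (\<forall>a\<in>S. \<exists>D. (F has_derivative D) (at a) \<and> (\<forall>c x. D (c *\<^sub>C x) = c *\<^sub>C D x))"

(* has_directional_derivs F b k a v: the iterated derivative of F at a in directions
   b 1, ..., b k (b 1 innermost, complex parameters) exists and equals v.  The lower order
   derivative is only required to exist at a + s b_k for s near 0, which is what is needed to
   form d/ds at s = 0. *)
primrec has_directional_derivs ::
    "('a::complex_banach \<Rightarrow> 'b::complex_banach) \<Rightarrow> (nat \<Rightarrow> 'a) \<Rightarrow> nat \<Rightarrow> 'a \<Rightarrow> 'b \<Rightarrow> bool" where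
  "has_directional_derivs F b 0 a v \<longleftrightarrow> F a = v"
| "has_directional_derivs F b (Suc k) a v \<longleftrightarrow>
     (\<exists>G :: complex \<Rightarrow> 'b.
        (\<forall>\<^sub>F s in nhds 0. has_directional_derivs F b k (a + s *\<^sub>C b (Suc k)) (G s)) \<and>
        (G has_derivative (\<lambda>s. s *\<^sub>C v)) (at 0))"

end

theory Submission
  imports Defs "HOL-Combinatorics.Multiset_Permutations"
begin

text \<open>
  The integral that defines \<open>f(a)\<close> depends on \<open>a\<close> through the resolvent alone, as long as the cycle
  stays fixed. By upper semicontinuity of the spectrum a cycle that surrounds the spectrum of \<open>a\<close> also surrounds
  the spectra of all nearby elements (lemma \<open>eventually_surrounds\<close>), so near \<open>a\<close> the calculus may be
  differentiated under the integral sign. The derivative of the resolvent \<open>R\<close> in direction \<open>b\<close> is \<open>R b R\<close>. Hence, by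
  the product rule, differentiating a word \<open>R b\<^sub>1 R \<dots> b\<^sub>k R\<close> in direction \<open>b\<close> inserts \<open>b\<close> at every
  possible place (lemma \<open>has_derivative_interleave\<close>), and inserting the last letter into
  the arrangements of the first \<open>k\<close> ones produces all arrangements of \<open>k + 1\<close> letters (lemma
  \<open>sum_permutations_Suc\<close>). That is the sum over the symmetric group.

  Two facts about cycles make this rigorous. The integral must not depend on the cycle, and a surrounding cycle must exist
  (theorems \<open>homologous_cycles_integral_eq\<close> and \<open>surrounding_cycle_exists\<close>). Both are
  obtained on a fine square grid. Every cycle in an open set \<open>V\<close> has the same integrals as some cycle of
  grid edges in \<open>V\<close>, for all holomorphic integrands at once (lemma
  \<open>cycle_grid_approximation\<close>). A cycle of grid edges is a combination of boundaries of grid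
  squares, with the winding numbers as multiplicities (lemmas \<open>grid_cycle_eq_sum_squares\<close> and
  \<open>grid_cycle_winding\<close>). So if it does not wind around any point outside \<open>V\<close>, then only squares inside
  \<open>V\<close> occur, and over their boundaries the integral is zero because the integrand has a primitive. Conversely, the
  boundary of the union of all squares that meet a compact set surrounds that set.

  The curves of a cycle are continuous and continuously differentiable off finitely many points,
  but their derivative may be unbounded and their length infinite. Integrals over them exist
  through primitives and are not controlled by the supremum of the integrand. For this reason
  nothing is ever estimated or differentiated along the given cycle; it is first replaced by
  finitely many segments that depend only on the cycle and on a compact set outside the
  spectrum (lemma \<open>cycle_localisation\<close>).
\<close>

section \<open>Primitives of vector-valued holomorphic functions\<close>

lemma scaleC_of_real_mult: "(complex_of_real r * c) *\<^sub>C x = r *\<^sub>R (c *\<^sub>C x)"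
  by (metis scaleC_of_real scaleC_scaleC)

lemma bounded_bilinear_scaleC:
  "bounded_bilinear (scaleC :: complex \<Rightarrow> 'a::complex_normed_vector \<Rightarrow> 'a)"
proof
  fix r :: real and c :: complex and x :: 'a
  show "(r *\<^sub>R c) *\<^sub>C x = r *\<^sub>R (c *\<^sub>C x)"
    by (simp add: scaleR_conv_of_real scaleC_of_real_mult)
  show "c *\<^sub>C (r *\<^sub>R x) = r *\<^sub>R (c *\<^sub>C x)"
    by (metis scaleC_of_real scaleC_scaleC mult.commute)
  show "\<exists>K. \<forall>(a::complex) (b::'a). norm (a *\<^sub>C b) \<le> norm a * norm b * K"
    by (rule exI[of _ 1]) (simp add: norm_scaleC)
qed (simp_all add: scaleC_add_left scaleC_add_right)

interpretation scaleC: bounded_bilinear "scaleC :: complex \<Rightarrow> 'a::complex_normed_vector \<Rightarrow> 'a"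
  by (rule bounded_bilinear_scaleC)

lemmas [continuous_intros] = scaleC.continuous_on

lemma scaleC_one [simp]: "1 *\<^sub>C x = x"
  using scaleC_of_real[of 1 x] by simp

lemma scaleC_eq_0_iff [simp]: "c *\<^sub>C x = 0 \<longleftrightarrow> c = 0 \<or> x = 0"
  by (metis norm_scaleC norm_eq_zero mult_eq_0_iff)

lemma scaleC_left_commute: "c *\<^sub>C (d *\<^sub>C x) = d *\<^sub>C (c *\<^sub>C x)"
  by (simp add: scaleC_scaleC mult.commute)

text \<open>
  A vector-valued analogue of holomorphy that carries the continuity of the derivative along as data.
  All integrands below are products of a scalar holomorphic function with resolvents, for which
  the continuity is visible, and with it primitives come from differentiating under an integral
  sign, without Goursat's lemma.
\<close>
definition C1_holomorphic_on :: "(complex \<Rightarrow> 'a::complex_banach) \<Rightarrow> complex set \<Rightarrow> bool" where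
  "C1_holomorphic_on g V \<longleftrightarrow>
     (\<exists>g'. continuous_on V g' \<and> (\<forall>z\<in>V. (g has_derivative (\<lambda>h. h *\<^sub>C g' z)) (at z)))"

lemma C1_holomorphic_on_subset: "C1_holomorphic_on g V \<Longrightarrow> W \<subseteq> V \<Longrightarrow> C1_holomorphic_on g W"
  unfolding C1_holomorphic_on_def by (meson continuous_on_subset subsetD)

lemma C1_holomorphic_on_imp_continuous_on: "C1_holomorphic_on g V \<Longrightarrow> continuous_on V g"
  unfolding C1_holomorphic_on_def
  by (meson continuous_at_imp_continuous_on has_derivative_continuous)

text \<open>
  Leibniz's rule for a complex parameter: the real Frechet derivative of the integrand is
  multiplication by \<open>g' s t\<close>, and the bounded linear map \<open>v \<mapsto> (h \<mapsto> h *\<^sub>C v)\<close> commutes with the integral.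
\<close>
lemma has_complex_derivative_integral:
  fixes g :: "complex \<Rightarrow> real \<Rightarrow> 'a::complex_banach"
  assumes deriv: "\<And>s t. s \<in> S \<Longrightarrow> t \<in> {0..1} \<Longrightarrow>
      ((\<lambda>s. g s t) has_derivative (\<lambda>h. h *\<^sub>C g' s t)) (at s within S)"
    and cont: "\<And>s. s \<in> S \<Longrightarrow> continuous_on {0..1} (g s)"
    and cont': "continuous_on (S \<times> {0..1}) (\<lambda>(s, t). g' s t)"
    and "convex S" "s0 \<in> S"
  shows "((\<lambda>s. integral {0..1} (g s)) has_derivative (\<lambda>h. h *\<^sub>C integral {0..1} (g' s0))) (at s0 within S)"
proof -
  let ?B = "scaleC.prod_left :: 'a \<Rightarrow> complex \<Rightarrow>\<^sub>L 'a"
  have c0: "continuous_on {0..1} (g' s0)"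
  proof -
    have "continuous_on {0..1} ((\<lambda>(s, t). g' s t) \<circ> (\<lambda>t. (s0, t)))"
      using \<open>s0 \<in> S\<close> by (intro continuous_on_compose continuous_intros continuous_on_subset[OF cont']) auto
    then show ?thesis by (simp add: o_def)
  qed
  have "((\<lambda>s. integral (cbox 0 1) (g s)) has_derivative integral (cbox 0 1) (\<lambda>t. ?B (g' s0 t))) (at s0 within S)"
  proof (rule leibniz_rule[where U = S])
    show "((\<lambda>s. g s t) has_derivative blinfun_apply (?B (g' s t))) (at s within S)"
      if "s \<in> S" "t \<in> cbox 0 1" for s t
      using deriv[OF that(1)] that(2) by simp
    show "g s integrable_on cbox 0 1" if "s \<in> S" for s
      using cont[OF that] by (simp add: integrable_continuous_real)
    show "continuous_on (S \<times> cbox 0 1) (\<lambda>(s, t). ?B (g' s t))"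
      using bounded_linear.continuous_on[OF scaleC.bounded_linear_prod_left cont'[folded box_real]]
      by (simp add: case_prod_unfold)
  qed (use assms in auto)
  moreover have "integral {0..1} (\<lambda>t. ?B (g' s0 t)) = ?B (integral {0..1} (g' s0))"
    using integral_linear[OF integrable_continuous_real[OF c0] scaleC.bounded_linear_prod_left]
    by (simp add: o_def)
  ultimately show ?thesis by simp
qed

text \<open>
  With a base point \<open>c\<close>, the integral \<open>F z\<close> of \<open>g\<close> along the segment from \<open>c\<close> to \<open>z\<close> is a primitive:
  under the integral sign its derivative is the integral over \<open>t\<close> of
  \<open>g (l z t) + t (z - c) *\<^sub>C g' (l z t)\<close>, which is the \<open>t\<close>-derivative of \<open>t *\<^sub>R g (l z t)\<close>
  and hence integrates to \<open>g z\<close>.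
\<close>
lemma primitive_on_convex:
  fixes g :: "complex \<Rightarrow> 'a::complex_banach"
  assumes g: "C1_holomorphic_on g V" and "S \<subseteq> V" "convex S"
  obtains F where "\<And>z. z \<in> S \<Longrightarrow> (F has_derivative (\<lambda>h. h *\<^sub>C g z)) (at z within S)"
proof (cases "S = {}")
  case False
  then obtain c where "c \<in> S" by blast
  obtain g' where c': "continuous_on V g'"
    and g': "\<And>z. z \<in> V \<Longrightarrow> (g has_derivative (\<lambda>h. h *\<^sub>C g' z)) (at z)"
    using g by (auto simp: C1_holomorphic_on_def)
  define l where "l z t = c + complex_of_real t * (z - c)" for z t
  have lS: "l z t \<in> S" if "z \<in> S" "t \<in> {0..1}" for z t
  proof -
    have "l z t = (1 - t) *\<^sub>R c + t *\<^sub>R z"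
      by (simp add: l_def scaleR_conv_of_real algebra_simps)
    then show ?thesis using \<open>convex S\<close> \<open>c \<in> S\<close> that by (simp add: convexD_alt)
  qed
  have lV: "l z t \<in> V" if "z \<in> S" "t \<in> {0..1}" for z t
    using lS[OF that] \<open>S \<subseteq> V\<close> by blast
  define F where "F z = integral {0..1} (\<lambda>t. (z - c) *\<^sub>C g (l z t))" for z
  define u where "u z t = g (l z t) + (complex_of_real t * (z - c)) *\<^sub>C g' (l z t)" for z t
  have cg: "continuous_on V g"
    using g by (rule C1_holomorphic_on_imp_continuous_on)
  have comp: "continuous_on (S \<times> {0..1}) (\<lambda>p. k (l (fst p) (snd p)))"
    if "continuous_on V k" for k :: "complex \<Rightarrow> 'a"
    by (rule continuous_on_compose2[OF that])
       (auto simp: l_def intro!: continuous_intros lV[unfolded l_def])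
  have comp1: "continuous_on {0..1} (\<lambda>t. k (l z t))"
    if "continuous_on V k" "z \<in> S" for k :: "complex \<Rightarrow> 'a" and z
    by (rule continuous_on_compose2[OF that(1)])
       (auto simp: l_def intro!: continuous_intros lV[unfolded l_def] that)
  have "(F has_derivative (\<lambda>h. h *\<^sub>C g z)) (at z within S)" if "z \<in> S" for z
  proof -
    have "(F has_derivative (\<lambda>h. h *\<^sub>C integral {0..1} (u z))) (at z within S)"
      unfolding F_def
    proof (rule has_complex_derivative_integral)
      fix s t assume s: "s \<in> S" and t: "t \<in> {0..1::real}"
      have "((\<lambda>s. l s t) has_derivative (\<lambda>h. complex_of_real t * h)) (at s within S)"
        unfolding l_def by (auto intro!: derivative_eq_intros)
      from has_derivative_compose[OF this g'[OF lV[OF s t]]]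
      have d: "((\<lambda>s. g (l s t)) has_derivative (\<lambda>h. (complex_of_real t * h) *\<^sub>C g' (l s t))) (at s within S)"
        by simp
      have "((\<lambda>s. s - c) has_derivative (\<lambda>h. h)) (at s within S)"
        by (auto intro!: derivative_eq_intros)
      from scaleC.FDERIV[OF this d]
      show "((\<lambda>s. (s - c) *\<^sub>C g (l s t)) has_derivative (\<lambda>h. h *\<^sub>C u s t)) (at s within S)"
        by (rule has_derivative_eq_rhs)
           (auto simp: u_def scaleC_add_right scaleC_scaleC algebra_simps)
    next
      show "continuous_on (S \<times> {0..1}) (\<lambda>(s, t). u s t)"
        unfolding u_def case_prod_unfold
        by (intro continuous_intros comp c' cg)
      show "continuous_on {0..1} (\<lambda>t. (s - c) *\<^sub>C g (l s t))" if "s \<in> S" for s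
        by (intro continuous_intros comp1 cg that)
    qed (use assms \<open>z \<in> S\<close> in auto)
    moreover have "integral {0..1} (u z) = g z"
    proof -
      have "(u z has_integral (1 *\<^sub>R g (l z 1) - 0 *\<^sub>R g (l z 0))) {0..1}"
      proof (rule fundamental_theorem_of_calculus)
        fix t :: real assume t: "t \<in> {0..1}"
        have "(l z has_derivative (\<lambda>h. complex_of_real h * (z - c))) (at t within {0..1})"
          unfolding l_def by (auto intro!: derivative_eq_intros)
        from has_derivative_compose[OF this g'[OF lV[OF \<open>z \<in> S\<close> t]]]
        have "((\<lambda>t. g (l z t)) has_derivative (\<lambda>h. h *\<^sub>R ((z - c) *\<^sub>C g' (l z t)))) (at t within {0..1})"
          by (simp add: scaleC_of_real_mult)
        then show "((\<lambda>t. t *\<^sub>R g (l z t)) has_vector_derivative u z t) (at t within {0..1})"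
          unfolding has_vector_derivative_def u_def
          by (auto intro!: derivative_eq_intros simp: scaleC_of_real_mult scaleR_add_right mult.commute)
      qed simp
      then show ?thesis by (simp add: integral_unique l_def)
    qed
    ultimately show ?thesis by simp
  qed
  then show thesis by (rule that)
qed (use that in auto)

definition path_integral :: "(real \<Rightarrow> complex) \<Rightarrow> (complex \<Rightarrow> 'a::complex_banach) \<Rightarrow> 'a" where
  "path_integral \<gamma> g =
     integral {0..1} (\<lambda>t. vector_derivative \<gamma> (at t within {0..1}) *\<^sub>C g (\<gamma> t))"

lemma cycle_integral_eq: "cycle_integral \<Gamma> g = (\<Sum>\<gamma>\<leftarrow>\<Gamma>. path_integral \<gamma> g)"
  by (simp add: cycle_integral_def path_integral_def)

text \<open>
  The gauge integral makes this true for every curve that is continuous and continuously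
  differentiable off a finite set. Such a curve may have an unbounded derivative and infinite
  length, so the primitive is what guarantees that the integral exists; a bound on \<open>g\<close> would not.
\<close>
lemma has_integral_along_path_primitive:
  fixes g :: "complex \<Rightarrow> 'a::complex_banach"
  assumes "valid_path \<gamma>" and ab: "0 \<le> a" "a \<le> b" "b \<le> 1" and S: "\<gamma> ` {a..b} \<subseteq> S"
    and F: "\<And>z. z \<in> S \<Longrightarrow> (F has_derivative (\<lambda>h. h *\<^sub>C g z)) (at z within S)"
  shows "((\<lambda>t. vector_derivative \<gamma> (at t within {0..1}) *\<^sub>C g (\<gamma> t)) has_integral
           (F (\<gamma> b) - F (\<gamma> a))) {a..b}"
proof -
  obtain T where "finite T" and T: "\<gamma> C1_differentiable_on {0..1} - T" and c: "continuous_on {0..1} \<gamma>"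
    using assms(1) by (auto simp: valid_path_def piecewise_C1_differentiable_on_def)
  show ?thesis
  proof (rule fundamental_theorem_of_calculus_interior_strong[OF \<open>finite T\<close>, where f = "\<lambda>t. F (\<gamma> t)"])
    fix x assume x: "x \<in> {a<..<b} - T"
    then have x01: "x \<in> {0..1} - T" "0 < x" "x < 1" using ab by auto
    have d: "(\<gamma> has_vector_derivative vector_derivative \<gamma> (at x)) (at x)"
      using T x01 by (metis C1_differentiable_on_eq vector_derivative_works)
    then have v: "vector_derivative \<gamma> (at x within {0..1}) = vector_derivative \<gamma> (at x)"
      using x01 by (intro vector_derivative_at_within_ivl) auto
    have "(\<gamma> has_derivative (\<lambda>h. h *\<^sub>R vector_derivative \<gamma> (at x))) (at x within {a<..<b})"
      using d by (simp add: has_vector_derivative_def has_derivative_at_withinI)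
    moreover have "(F has_derivative (\<lambda>h. h *\<^sub>C g (\<gamma> x))) (at (\<gamma> x) within \<gamma> ` {a<..<b})"
      using x S by (intro has_derivative_subset[OF F]) auto
    ultimately have "((\<lambda>t. F (\<gamma> t)) has_derivative
        (\<lambda>h. (h *\<^sub>R vector_derivative \<gamma> (at x)) *\<^sub>C g (\<gamma> x))) (at x within {a<..<b})"
      using diff_chain_within by (force simp: o_def)
    then have "((\<lambda>t. F (\<gamma> t)) has_derivative
        (\<lambda>h. (h *\<^sub>R vector_derivative \<gamma> (at x)) *\<^sub>C g (\<gamma> x))) (at x)"
      using x by (simp add: at_within_open[of x "{a<..<b}"])
    then show "((\<lambda>t. F (\<gamma> t)) has_vector_derivative
        vector_derivative \<gamma> (at x within {0..1}) *\<^sub>C g (\<gamma> x)) (at x)"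
      by (simp add: v has_vector_derivative_def scaleC.scaleR_left)
  next
    have "continuous_on S F"
      using F has_derivative_continuous continuous_on_eq_continuous_within by blast
    moreover have "continuous_on {a..b} \<gamma>" using c ab by (auto intro: continuous_on_subset)
    ultimately show "continuous_on {a..b} (\<lambda>t. F (\<gamma> t))"
      using S by (rule continuous_on_compose2)
  qed fact
qed

lemma path_integral_linepath_primitive:
  fixes g :: "complex \<Rightarrow> 'a::complex_banach"
  assumes "convex S" "x \<in> S" "y \<in> S"
    and F: "\<And>z. z \<in> S \<Longrightarrow> (F has_derivative (\<lambda>h. h *\<^sub>C g z)) (at z within S)"
  shows "path_integral (linepath x y) g = F y - F x"
proof -
  have "linepath x y ` {0..1} \<subseteq> S"
    using assms(1-3) path_image_linepath[of x y] closed_segment_subset[of x S y]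
    by (simp add: path_image_def)
  from has_integral_along_path_primitive[OF valid_path_linepath, of 0 1 x y S F g, OF _ _ _ this F]
  show ?thesis
    by (simp add: path_integral_def integral_unique linepath_0' linepath_1')
qed

lemma path_integral_linepath_eq:
  "path_integral (linepath x y) g = integral {0..1} (\<lambda>t. (y - x) *\<^sub>C g (linepath x y t))"
  unfolding path_integral_def
  by (intro integral_cong) (simp add: vector_derivative_linepath_within)

text \<open>
  Vector-valued integrals of a pole times a fixed nonzero vector recover winding numbers. A
  statement about all vector-valued integrals thereby also determines the winding numbers.
\<close>
lemma path_integral_pole:
  fixes v :: "'a::complex_banach"
  assumes "valid_path \<gamma>" "z \<notin> path_image \<gamma>"
  shows "path_integral \<gamma> (\<lambda>w. (1 / (w - z)) *\<^sub>C v) = (2 * of_real pi * \<i> * winding_number \<gamma> z) *\<^sub>C v"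
proof -
  have "((\<lambda>w. 1 / (w - z)) has_contour_integral (2 * of_real pi * \<i> * winding_number \<gamma> z)) \<gamma>"
    using has_contour_integral_integral[OF contour_integrable_inversediff[OF assms]]
    by (simp add: winding_number_valid_path[OF assms])
  then have "((\<lambda>t. (1 / (\<gamma> t - z) * vector_derivative \<gamma> (at t within {0..1})) *\<^sub>C v) has_integral
     (2 * of_real pi * \<i> * winding_number \<gamma> z) *\<^sub>C v) {0..1}"
    unfolding has_contour_integral_def
    by (rule has_integral_linear[OF _ scaleC.bounded_linear_left, unfolded o_def])
  then show ?thesis
    unfolding path_integral_def by (intro integral_unique) (simp add: scaleC_scaleC mult.commute)
qed

lemma C1_holomorphic_on_pole:
  fixes v :: "'a::complex_banach"
  assumes "z \<notin> V"
  shows "C1_holomorphic_on (\<lambda>w. (1 / (w - z)) *\<^sub>C v) V"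
  unfolding C1_holomorphic_on_def
proof (intro exI conjI ballI)
  show "continuous_on V (\<lambda>w. (- 1 / (w - z)^2) *\<^sub>C v)"
    using assms by (intro continuous_intros) auto
  fix w assume "w \<in> V"
  then have "w \<noteq> z" using assms by auto
  then have "((\<lambda>w. 1 / (w - z)) has_field_derivative (- 1 / (w - z)^2)) (at w)"
    by (auto intro!: derivative_eq_intros simp: power2_eq_square)
  then have "((\<lambda>w. 1 / (w - z)) has_derivative (\<lambda>h. h * (- 1 / (w - z)^2))) (at w)"
    unfolding has_field_derivative_def
    by (rule has_derivative_eq_rhs) (simp add: fun_eq_iff mult.commute)
  from bounded_linear.has_derivative[OF scaleC.bounded_linear_left this]
  show "((\<lambda>w. (1 / (w - z)) *\<^sub>C v) has_derivative (\<lambda>h. h *\<^sub>C ((- 1 / (w - z)^2) *\<^sub>C v))) (at w)"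
    by (simp add: scaleC_scaleC)
qed

section \<open>One-chains on the square grid\<close>

type_synonym edge = "(int \<times> int) \<times> (int \<times> int)"

definition grid_point :: "real \<Rightarrow> int \<times> int \<Rightarrow> complex" where
  "grid_point \<delta> p = Complex (\<delta> * of_int (fst p)) (\<delta> * of_int (snd p))"

text \<open>
  Degenerate edges from a vertex to itself are included: a curve may stay in the same grid square
  for a while, and its grid walk then stands still.
\<close>
definition grid_step :: "int \<times> int \<Rightarrow> int \<times> int \<Rightarrow> bool" where
  "grid_step p q \<longleftrightarrow> fst p = fst q \<and> \<bar>snd p - snd q\<bar> \<le> 1 \<or> snd p = snd q \<and> \<bar>fst p - fst q\<bar> \<le> 1"

definition edge_path :: "real \<Rightarrow> edge \<Rightarrow> real \<Rightarrow> complex" where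
  "edge_path \<delta> e = linepath (grid_point \<delta> (fst e)) (grid_point \<delta> (snd e))"

text \<open>
  The four edges of the square with lower left corner \<open>s\<close>, counterclockwise.
\<close>
definition square_boundary :: "int \<times> int \<Rightarrow> edge list" where
  "square_boundary s = (let (m, n) = s in
     [((m, n), (m + 1, n)), ((m + 1, n), (m + 1, n + 1)),
      ((m + 1, n + 1), (m, n + 1)), ((m, n + 1), (m, n))])"

text \<open>
  The sum of \<open>w\<close> along the walk from \<open>(B, B)\<close> to \<open>p\<close> that goes along the bottom line first and then
  straight up. The weight of a vertical edge is the difference of the potentials at its ends; for horizontal
  edges this fails, and the defect is measured by the squares below them.
\<close>
definition grid_potential :: "int \<Rightarrow> (edge \<Rightarrow> 'a::real_vector) \<Rightarrow> int \<times> int \<Rightarrow> 'a" where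
  "grid_potential B w p =
     (\<Sum>j\<in>{B..<fst p}. w ((j, B), (j + 1, B))) + (\<Sum>j\<in>{B..<snd p}. w ((fst p, j), (fst p, j + 1)))"

text \<open>
  The multiplicities, with sign, of the squares in the column below a horizontal edge; a vertical
  or degenerate edge gets zero.
\<close>
definition column_coeff :: "int \<Rightarrow> edge \<Rightarrow> int \<times> int \<Rightarrow> real" where
  "column_coeff B e s =
     (if snd s \<in> {B..<snd (fst e)} then
        (if fst (snd e) = fst (fst e) + 1 \<and> fst s = fst (fst e) then - 1
         else if fst (fst e) = fst (snd e) + 1 \<and> fst s = fst (snd e) then 1 else 0)
      else 0)"

lemma atLeastLessThan_int_snoc: "B \<le> n \<Longrightarrow> {B..<n + 1} = insert n {B..<n::int}"
  by auto

text \<open>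
  Weights that change sign when an edge is reversed. Path integrals along edges and winding
  numbers of edges are of this kind, once they are set to zero on the edges where they are not
  meaningful.
\<close>
definition antisymmetric :: "('b \<times> 'b \<Rightarrow> 'a::real_vector) \<Rightarrow> bool" where
  "antisymmetric w \<longleftrightarrow> (\<forall>p q. w (q, p) = - w (p, q))"

lemma antisymmetricD: "antisymmetric w \<Longrightarrow> w (p, q) = - w (q, p)"
  unfolding antisymmetric_def by blast

lemma eq_uminus_self_imp_0:
  fixes x :: "'a::real_vector"
  assumes a: "x = - x"
  shows "x = 0"
proof -
  have "x + x = 0"
    using eq_neg_iff_add_eq_0[of x x] a by (rule iffD1)
  then have "2 *\<^sub>R x = 0"
    by (simp only: scaleR_2)
  then show "x = 0" using scaleR_eq_0_iff[of 2 x] by (metis zero_neq_numeral)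
qed

lemma antisymmetric_loop_0:
  assumes "antisymmetric w"
  shows "w (p, p) = 0"
  by (rule eq_uminus_self_imp_0[OF antisymmetricD[OF assms]])

lemma vertical_edge_potential:
  assumes "B \<le> n"
  shows "grid_potential B w (m, n + 1) - grid_potential B w (m, n) = w ((m, n), (m, n + 1))"
  using assms by (simp add: grid_potential_def atLeastLessThan_int_snoc)

text \<open>
  Going around the column of squares below the edge: the vertical sides are differences of the
  potential and the bottom side is on the line where the potential is the sum of the weights.
\<close>
lemma horizontal_edge_potential:
  fixes w :: "edge \<Rightarrow> 'a::real_vector"
  assumes anti: "antisymmetric w" and "B \<le> m" "B \<le> n"
  shows "w ((m, n), (m + 1, n)) = grid_potential B w (m + 1, n) - grid_potential B w (m, n)
           - (\<Sum>j\<in>{B..<n}. \<Sum>e\<leftarrow>square_boundary (m, j). w e)"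
  using \<open>B \<le> n\<close>
proof (induction n rule: int_ge_induct)
  case base
  show ?case using \<open>B \<le> m\<close> by (simp add: grid_potential_def atLeastLessThan_int_snoc)
next
  case (step n)
  note v = vertical_edge_potential[OF step.hyps, of w m] vertical_edge_potential[OF step.hyps, of w "m + 1"]
  have top: "w ((m, n + 1), (m + 1, n + 1)) = w ((m, n), (m + 1, n)) + w ((m + 1, n), (m + 1, n + 1))
      - w ((m, n), (m, n + 1)) - (\<Sum>e\<leftarrow>square_boundary (m, n). w e)"
    by (simp add: square_boundary_def antisymmetricD[OF anti, of "(m + 1, n + 1)" "(m, n + 1)"]
        antisymmetricD[OF anti, of "(m, n + 1)" "(m, n)"])
  have "(\<Sum>j\<in>{B..<n + 1}. \<Sum>e\<leftarrow>square_boundary (m, j). w e) =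
     (\<Sum>e\<leftarrow>square_boundary (m, n). w e) + (\<Sum>j\<in>{B..<n}. \<Sum>e\<leftarrow>square_boundary (m, j). w e)"
    using step.hyps by (simp add: atLeastLessThan_int_snoc)
  then show ?case
    unfolding top step.IH v[symmetric] by simp
qed

lemma edge_eq_potential_plus_squares:
  fixes w :: "edge \<Rightarrow> 'a::real_vector"
  assumes anti: "antisymmetric w" and step: "grid_step p q"
    and B: "p \<in> {B..C} \<times> {B..C}" "q \<in> {B..C} \<times> {B..C}"
  shows "w (p, q) = grid_potential B w q - grid_potential B w p
     + (\<Sum>s\<in>{B..C} \<times> {B..C}. column_coeff B (p, q) s *\<^sub>R (\<Sum>e\<leftarrow>square_boundary s. w e))"
proof -
  have col: "(\<Sum>s\<in>{B..C} \<times> {B..C}. (if snd s \<in> {B..<n} \<and> fst s = m then c else 0) *\<^sub>R f s)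
     = c *\<^sub>R (\<Sum>j\<in>{B..<n}. f (m, j))" if "m \<in> {B..C}" "n \<in> {B..C}" for m n c and f :: "_ \<Rightarrow> 'a"
  proof -
    have "(\<Sum>s\<in>{B..C} \<times> {B..C}. (if snd s \<in> {B..<n} \<and> fst s = m then c else 0) *\<^sub>R f s)
        = (\<Sum>s\<in>{m} \<times> {B..<n}. c *\<^sub>R f s)"
      using that by (intro sum.mono_neutral_cong_right) (auto simp: mem_Times_iff)
    also have "\<dots> = c *\<^sub>R (\<Sum>j\<in>{B..<n}. f (m, j))"
      by (simp add: sum.cartesian_product' flip: scaleR_sum_right)
    finally show ?thesis .
  qed
  obtain m n where p: "p = (m, n)" by (cases p)
  have mn: "m \<in> {B..C}" "n \<in> {B..C}" using B p by auto
  consider "q = (m + 1, n)" | "q = (m - 1, n)" | "fst q = m"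
  proof -
    have "fst q = m \<or> snd q = n \<and> (fst q = m + 1 \<or> fst q = m - 1)"
      using step p unfolding grid_step_def by (smt (verit) fst_conv snd_conv)
    then show thesis using that by (metis prod.collapse)
  qed
  then show ?thesis
  proof cases
    case 1
    then have "column_coeff B (p, q) = (\<lambda>s. if snd s \<in> {B..<n} \<and> fst s = m then - 1 else 0)"
      by (auto simp: column_coeff_def p)
    then show ?thesis
      using horizontal_edge_potential[OF anti, of B m n] mn 1 p
      by (simp only: col[OF mn]) simp
  next
    case 2
    then have m: "m - 1 \<in> {B..C}" using B by auto
    have "column_coeff B (p, q) = (\<lambda>s. if snd s \<in> {B..<n} \<and> fst s = m - 1 then 1 else 0)"
      using 2 by (auto simp: column_coeff_def p)
    then show ?thesis
      using horizontal_edge_potential[OF anti, of B "m - 1" n] mn m 2 p antisymmetricD[OF anti, of p q]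
      by (simp only: col[OF m mn(2)]) (simp add: algebra_simps)
  next
    case 3
    then have "column_coeff B (p, q) = (\<lambda>s. 0)"
      by (auto simp: column_coeff_def p)
    moreover obtain n' where q: "q = (m, n')" using 3 by (cases q) auto
    moreover have "w (p, q) = grid_potential B w q - grid_potential B w p"
    proof -
      consider "n' = n" | "n' = n + 1" | "n = n' + 1"
        using step p q unfolding grid_step_def by force
      then show ?thesis
      proof cases
        case 1
        then show ?thesis using antisymmetric_loop_0[OF anti] p q by simp
      next
        case 2
        then show ?thesis using vertical_edge_potential[of B n w m] mn p q by simp
      next
        case 3
        then show ?thesis
          using vertical_edge_potential[of B n' w m] antisymmetricD[OF anti, of p q] B p q
          by (simp add: algebra_simps)
      qed
    qed
    ultimately show ?thesis by simp
  qed
qed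

text \<open>
  If every vertex occurs equally often as an initial and as a final vertex, then each value of the
  potential is added and subtracted equally often. This is the only way in which closedness of a
  grid cycle enters.
\<close>
lemma sum_list_potential_balanced:
  fixes h :: "'b \<Rightarrow> 'a::real_vector"
  assumes "mset (map fst L) = mset (map snd L)"
  shows "(\<Sum>e\<leftarrow>L. h (snd e) - h (fst e)) = 0"
proof -
  have "(\<Sum>e\<leftarrow>L. h (snd e)) = sum_mset (image_mset h (mset (map snd L)))"
    by (simp add: sum_mset_sum_list[symmetric] image_mset.compositionality o_def)
  also have "\<dots> = (\<Sum>e\<leftarrow>L. h (fst e))"
    unfolding assms[symmetric]
    by (simp add: sum_mset_sum_list[symmetric] image_mset.compositionality o_def)
  finally show ?thesis by (simp add: sum_list_subtractf)
qed

text \<open>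
  How often a list of edges winds around a square, by counting its horizontal edges above that square.
  This is a definition without integrals, so the same coefficients serve for all weights.
\<close>
definition winding_coeff :: "int \<Rightarrow> edge list \<Rightarrow> int \<times> int \<Rightarrow> real" where
  "winding_coeff B L s = (\<Sum>e\<leftarrow>L. column_coeff B e s)"

text \<open>
  Every one-cycle of the grid is a boundary: a closed list of edges is, as far as antisymmetric
  weights can see, the combination of the square boundaries with the coefficients \<open>winding_coeff\<close>.
\<close>
lemma grid_cycle_eq_sum_squares:
  fixes w :: "edge \<Rightarrow> 'a::real_vector"
  assumes anti: "antisymmetric w"
    and L: "\<And>p q. (p, q) \<in> set L \<Longrightarrow> grid_step p q \<and> p \<in> {B..C} \<times> {B..C} \<and> q \<in> {B..C} \<times> {B..C}"
    and "mset (map fst L) = mset (map snd L)"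
  shows "(\<Sum>e\<leftarrow>L. w e) =
     (\<Sum>s\<in>{B..C} \<times> {B..C}. winding_coeff B L s *\<^sub>R (\<Sum>e\<leftarrow>square_boundary s. w e))"
proof -
  have "(\<Sum>e\<leftarrow>L. w e) = (\<Sum>e\<leftarrow>L. grid_potential B w (snd e) - grid_potential B w (fst e))
     + (\<Sum>s\<in>{B..C} \<times> {B..C}. winding_coeff B L s *\<^sub>R (\<Sum>e\<leftarrow>square_boundary s. w e))"
    using L
  proof (induction L)
    case (Cons e L)
    obtain p q where e: "e = (p, q)" by (cases e)
    have "w e = grid_potential B w (snd e) - grid_potential B w (fst e)
       + (\<Sum>s\<in>{B..C} \<times> {B..C}. column_coeff B e s *\<^sub>R (\<Sum>e\<leftarrow>square_boundary s. w e))"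
      using Cons.prems[of p q] edge_eq_potential_plus_squares[OF anti, of p q B C] by (simp add: e)
    moreover have "(\<Sum>e\<leftarrow>L. w e) = (\<Sum>e\<leftarrow>L. grid_potential B w (snd e) - grid_potential B w (fst e))
     + (\<Sum>s\<in>{B..C} \<times> {B..C}. winding_coeff B L s *\<^sub>R (\<Sum>e\<leftarrow>square_boundary s. w e))"
      by (rule Cons.IH) (use Cons.prems in auto)
    ultimately show ?case
      by (simp add: winding_coeff_def scaleR_add_left sum.distrib)
  qed (simp add: winding_coeff_def)
  then show ?thesis using sum_list_potential_balanced[OF assms(3)] by simp
qed

section \<open>Winding numbers of grid cycles\<close>

definition grid_square :: "real \<Rightarrow> int \<times> int \<Rightarrow> complex set" where
  "grid_square \<delta> s = cbox (grid_point \<delta> s) (grid_point \<delta> (fst s + 1, snd s + 1))"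

definition grid_cell :: "real \<Rightarrow> int \<times> int \<Rightarrow> complex set" where
  "grid_cell \<delta> s = box (grid_point \<delta> s) (grid_point \<delta> (fst s + 1, snd s + 1))"

lemma mem_grid_square: "z \<in> grid_square \<delta> s \<longleftrightarrow>
    Re z \<in> {\<delta> * of_int (fst s)..\<delta> * (of_int (fst s) + 1)} \<and>
    Im z \<in> {\<delta> * of_int (snd s)..\<delta> * (of_int (snd s) + 1)}"
  by (simp add: grid_square_def in_cbox_complex_iff grid_point_def)

lemma mem_grid_cell: "z \<in> grid_cell \<delta> s \<longleftrightarrow>
    Re z \<in> {\<delta> * of_int (fst s)<..<\<delta> * (of_int (fst s) + 1)} \<and>
    Im z \<in> {\<delta> * of_int (snd s)<..<\<delta> * (of_int (snd s) + 1)}"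
  by (simp add: grid_cell_def in_box_complex_iff grid_point_def)

lemma convex_grid_square: "convex (grid_square \<delta> s)"
  by (simp add: grid_square_def convex_box)

lemma path_image_edge_path: "path_image (edge_path \<delta> e) =
    closed_segment (grid_point \<delta> (fst e)) (grid_point \<delta> (snd e))"
  by (simp add: edge_path_def)

lemma valid_path_edge_path [simp]: "valid_path (edge_path \<delta> e)"
  by (simp add: edge_path_def)

lemma path_edge_path [simp]: "path (edge_path \<delta> e)"
  by (simp add: edge_path_def)

lemma scaled_floor_bounds:
  assumes "\<delta> > (0::real)"
  shows "\<delta> * of_int \<lfloor>x / \<delta>\<rfloor> \<le> x" "x < \<delta> * (of_int \<lfloor>x / \<delta>\<rfloor> + 1)"
proof -
  have "of_int \<lfloor>x / \<delta>\<rfloor> \<le> x / \<delta>" "x / \<delta> < of_int \<lfloor>x / \<delta>\<rfloor> + 1" by linarith+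
  then show "\<delta> * of_int \<lfloor>x / \<delta>\<rfloor> \<le> x" "x < \<delta> * (of_int \<lfloor>x / \<delta>\<rfloor> + 1)"
    using assms by (simp_all only: pos_le_divide_eq pos_divide_less_eq mult.commute)
qed

lemma floor_grid_square:
  assumes "\<delta> > 0"
  shows "z \<in> grid_square \<delta> (\<lfloor>Re z / \<delta>\<rfloor>, \<lfloor>Im z / \<delta>\<rfloor>)"
  using scaled_floor_bounds[OF assms] by (simp add: mem_grid_square less_imp_le)

lemma square_boundary_subset:
  assumes "e \<in> set (square_boundary s)" "\<delta> > 0"
  shows "path_image (edge_path \<delta> e) \<subseteq> grid_square \<delta> s"
  unfolding path_image_edge_path
  by (rule closed_segment_subset[OF _ _ convex_grid_square])
     (use assms in \<open>auto simp: square_boundary_def mem_grid_square grid_point_def split: prod.splits\<close>)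

lemma grid_step_square_boundary:
  "(p, q) \<in> set (square_boundary s) \<Longrightarrow> grid_step p q"
  by (auto simp: square_boundary_def grid_step_def split: prod.splits)

text \<open>
  A point in an open cell is on no grid line, so all winding numbers of edges around it are
  meaningful.
\<close>
lemma grid_cell_avoids_edges:
  assumes "\<delta> > 0" "z \<in> grid_cell \<delta> s" "grid_step p q"
  shows "z \<notin> path_image (edge_path \<delta> (p, q))"
proof
  assume z: "z \<in> path_image (edge_path \<delta> (p, q))"
  have no_int: False if "\<delta> * of_int k < \<delta> * of_int m" "\<delta> * of_int m < \<delta> * (of_int k + 1)" for k m :: int
  proof -
    have "of_int k < (of_int m :: real)" "of_int m < (of_int (k + 1) :: real)"
      using that \<open>\<delta> > 0\<close> by auto
    then show False unfolding of_int_less_iff by linarith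
  qed
  show False
    using \<open>grid_step p q\<close> unfolding grid_step_def
  proof (elim disjE conjE)
    assume "fst p = fst q"
    then have "Re z = \<delta> * of_int (fst q)"
      using z by (simp add: path_image_edge_path closed_segment_same_Re grid_point_def)
    then show False using assms(2) no_int by (auto simp: mem_grid_cell)
  next
    assume "snd p = snd q"
    then have "Im z = \<delta> * of_int (snd q)"
      using z by (simp add: path_image_edge_path closed_segment_same_Im grid_point_def)
    then show False using assms(2) no_int by (auto simp: mem_grid_cell)
  qed
qed

lemma grid_cell_disjoint_squares:
  assumes "\<delta> > 0" "z \<in> grid_cell \<delta> s0" "z \<in> grid_square \<delta> s"
  shows "s = s0"
proof -
  have *: "k = l" if "\<delta> * of_int k < x" "x < \<delta> * (of_int k + 1)" "\<delta> * of_int l \<le> x" "x \<le> \<delta> * (of_int l + 1)"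
    for k l :: int and x
  proof -
    have "\<delta> * of_int k < \<delta> * (of_int l + 1)" "\<delta> * of_int l < \<delta> * (of_int k + 1)"
      using that by linarith+
    then have "of_int k < (of_int (l + 1) :: real)" "of_int l < (of_int (k + 1) :: real)"
      using \<open>\<delta> > 0\<close> by auto
    then show ?thesis unfolding of_int_less_iff by linarith
  qed
  show ?thesis
    using assms(2,3) *[of "fst s0" "Re z" "fst s"] *[of "snd s0" "Im z" "snd s"]
    by (auto simp: mem_grid_cell mem_grid_square prod_eq_iff)
qed

lemma winding_square_boundary:
  assumes "\<delta> > 0" "z \<in> grid_cell \<delta> s0"
  shows "(\<Sum>e\<leftarrow>square_boundary s. winding_number (edge_path \<delta> e) z) = (if s = s0 then 1 else 0)"
proof -
  obtain m n where s: "s = (m, n)" by (cases s)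
  let ?a = "grid_point \<delta> (m, n)" and ?c = "grid_point \<delta> (m + 1, n + 1)"
  have off: "z \<notin> path_image (edge_path \<delta> e)" if "e \<in> set (square_boundary s)" for e
    using that grid_step_square_boundary grid_cell_avoids_edges[OF assms] by (metis prod.collapse)
  have "(\<Sum>e\<leftarrow>square_boundary s. winding_number (edge_path \<delta> e) z) = winding_number (rectpath ?a ?c) z"
  proof -
    have r: "rectpath ?a ?c = edge_path \<delta> ((m, n), (m + 1, n)) +++ edge_path \<delta> ((m + 1, n), (m + 1, n + 1)) +++
      edge_path \<delta> ((m + 1, n + 1), (m, n + 1)) +++ edge_path \<delta> ((m, n + 1), (m, n))"
      by (simp add: rectpath_def edge_path_def grid_point_def Let_def)
    have o: "z \<notin> path_image (edge_path \<delta> ((m, n), (m + 1, n)))"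
      "z \<notin> path_image (edge_path \<delta> ((m + 1, n), (m + 1, n + 1)))"
      "z \<notin> path_image (edge_path \<delta> ((m + 1, n + 1), (m, n + 1)))"
      "z \<notin> path_image (edge_path \<delta> ((m, n + 1), (m, n)))"
      by (rule off, simp add: s square_boundary_def)+
    have ends: "pathstart (edge_path \<delta> e) = grid_point \<delta> (fst e)"
      "pathfinish (edge_path \<delta> e) = grid_point \<delta> (snd e)" for e
      by (simp_all add: edge_path_def)
    show ?thesis
      unfolding r by (simp add: winding_number_join path_image_join o ends s square_boundary_def)
  qed
  also have "\<dots> = (if s = s0 then 1 else 0)"
  proof (cases "s = s0")
    case True
    then show ?thesis
      using assms s by (auto simp: grid_cell_def winding_number_rectpath)
  next
    case False
    then have "z \<notin> grid_square \<delta> s" using grid_cell_disjoint_squares[OF assms] by blast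
    then show ?thesis
      using False winding_number_rectpath_outside[of ?a ?c z] assms(1)
      by (simp add: grid_square_def s) (simp add: grid_point_def)
  qed
  finally show ?thesis .
qed

text \<open>
  Winding numbers of edges vary continuously off the edges, and a closed square is the closure of its open cell.
  This carries a value computed in the open cell to boundary points that the
  edges of \<open>L\<close> do not meet, even if other edges of the grid pass through them.
\<close>
lemma winding_on_closed_square:
  fixes \<delta> :: real and L :: "edge list"
  assumes "\<delta> > 0" and cell: "\<And>z. z \<in> grid_cell \<delta> s \<Longrightarrow> (\<Sum>e\<leftarrow>L. winding_number (edge_path \<delta> e) z) = c"
    and z: "z \<in> grid_square \<delta> s" "\<And>e. e \<in> set L \<Longrightarrow> z \<notin> path_image (edge_path \<delta> e)"
  shows "(\<Sum>e\<leftarrow>L. winding_number (edge_path \<delta> e) z) = c"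
proof (cases "z \<in> grid_cell \<delta> s")
  case False
  let ?W = "\<lambda>z. \<Sum>e\<leftarrow>L. winding_number (edge_path \<delta> e) z"
  have "Complex (\<delta> * (of_int (fst s) + 1/2)) (\<delta> * (of_int (snd s) + 1/2)) \<in> grid_cell \<delta> s"
    using \<open>\<delta> > 0\<close> by (simp add: mem_grid_cell)
  then have "grid_square \<delta> s = closure (grid_cell \<delta> s)"
    unfolding grid_square_def grid_cell_def by (metis closure_box empty_iff)
  then have lim: "z islimpt grid_cell \<delta> s"
    using z(1) False by (simp add: closure_def)
  have "(?W \<longlongrightarrow> ?W z) (at z within grid_cell \<delta> s)"
    using z(2)
  proof (induction L)
    case (Cons e L)
    have "(winding_number (edge_path \<delta> e) \<longlongrightarrow> winding_number (edge_path \<delta> e) z) (at z within grid_cell \<delta> s)"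
      using continuous_at_winding_number[of "edge_path \<delta> e" z] Cons.prems
      by (metis continuous_within continuous_at_imp_continuous_at_within
          list.set_intros(1) path_edge_path)
    then show ?case using Cons by (auto intro!: tendsto_add)
  qed auto
  moreover have "(?W \<longlongrightarrow> c) (at z within grid_cell \<delta> s)"
    by (rule tendsto_eventually) (auto simp: eventually_at_filter cell)
  ultimately show ?thesis
    using lim by (intro tendsto_unique) (auto simp: trivial_limit_within)
qed (use cell in auto)

section \<open>Pushing a cycle onto the grid\<close>

text \<open>
  A closed curve is replaced by a closed grid walk. Sample the curve so finely that it moves less than \<open>\<delta>\<close>
  between two samples, and move every sample to the lower left corner \<open>v\<close> of its grid square. The
  corners \<open>v\<close> at successive samples differ by at most one in each coordinate and are joined by
  one horizontal and one vertical step, with the corner \<open>u\<close> in between. All this happens in a disc inside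
  \<open>V\<close>, where \<open>g\<close> has a primitive, so the two integrals over one
  sampling interval differ only by the integrals over the two short segments from the corners to the curve,
  and these cancel when the contributions are added up around the closed curve.
\<close>
lemma path_grid_approximation:
  fixes V :: "complex set"
  assumes \<gamma>: "valid_path \<gamma>" "pathfinish \<gamma> = pathstart \<gamma>" and "\<delta> > 0"
    and V: "\<And>t. t \<in> {0..1} \<Longrightarrow> ball (\<gamma> t) (4 * \<delta>) \<subseteq> V"
  obtains L where "\<And>p q. (p, q) \<in> set L \<Longrightarrow> grid_step p q \<and> path_image (edge_path \<delta> (p, q)) \<subseteq> V"
    and "mset (map fst L) = mset (map snd L)"
    and "\<And>g :: complex \<Rightarrow> 'a::complex_banach. C1_holomorphic_on g V \<Longrightarrow>
           path_integral \<gamma> g = (\<Sum>e\<leftarrow>L. path_integral (edge_path \<delta> e) g)"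
proof -
  have "uniformly_continuous_on {0..1} \<gamma>"
    using \<gamma>(1) by (intro compact_uniformly_continuous) (auto simp: path_def dest: valid_path_imp_path)
  then obtain d where "d > 0"
    and d: "\<And>s t. s \<in> {0..1} \<Longrightarrow> t \<in> {0..1} \<Longrightarrow> dist t s < d \<Longrightarrow> dist (\<gamma> t) (\<gamma> s) < \<delta>"
    unfolding uniformly_continuous_on_def using \<open>\<delta> > 0\<close> by metis
  obtain N :: nat where "N > 0" and N: "1 / real N < d"
    using real_arch_inverse[of d] \<open>d > 0\<close> by (auto simp: inverse_eq_divide)
  define \<tau> where "\<tau> i = real i / real N" for i
  have \<tau>01: "\<tau> i \<in> {0..1}" if "i \<le> N" for i
    using that \<open>N > 0\<close> by (simp add: \<tau>_def)
  have \<tau>_Suc: "\<tau> (Suc i) = \<tau> i + 1 / real N" for i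
    by (simp add: \<tau>_def add_divide_distrib)
  have \<tau>0: "\<tau> 0 = 0" and \<tau>N: "\<tau> N = 1" using \<open>N > 0\<close> by (simp_all add: \<tau>_def)
  \<comment> \<open>On a sampling interval the curve stays within \<open>\<delta>\<close> of the left sample.\<close>
  have near: "dist (\<gamma> (\<tau> i)) (\<gamma> t) < \<delta>" if "i < N" "t \<in> {\<tau> i..\<tau> (Suc i)}" for i t
  proof (rule d)
    show "t \<in> {0..1}" using that \<tau>01[of i] \<tau>01[of "Suc i"] by auto
    show "dist (\<tau> i) t < d" using that N by (auto simp: \<tau>_Suc dist_real_def)
  qed (use that \<tau>01[of i] in auto)
  define v where "v i = (\<lfloor>Re (\<gamma> (\<tau> i)) / \<delta>\<rfloor>, \<lfloor>Im (\<gamma> (\<tau> i)) / \<delta>\<rfloor>)" for i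
  define u where "u i = (fst (v (Suc i)), snd (v i))" for i
  define L where "L k = concat (map (\<lambda>i. [(v i, u i), (u i, v (Suc i))]) [0..<k])" for k
  have L_Suc: "L (Suc k) = L k @ [(v k, u k), (u k, v (Suc k))]" for k
    by (simp add: L_def)
  note fl = scaled_floor_bounds[OF \<open>\<delta> > 0\<close>]
  have fl_near: "\<bar>\<lfloor>x / \<delta>\<rfloor> - \<lfloor>y / \<delta>\<rfloor>\<bar> \<le> 1" if "\<bar>x - y\<bar> < \<delta>" for x y
  proof -
    have "\<bar>x / \<delta> - y / \<delta>\<bar> < 1"
      using that \<open>\<delta> > 0\<close> by (simp add: diff_divide_distrib[symmetric] abs_divide)
    then show ?thesis by linarith
  qed
  have close: "\<bar>Re (\<gamma> (\<tau> i)) - Re (\<gamma> (\<tau> (Suc i)))\<bar> < \<delta>" "\<bar>Im (\<gamma> (\<tau> i)) - Im (\<gamma> (\<tau> (Suc i)))\<bar> < \<delta>"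
    if "i < N" for i
  proof -
    have "dist (\<gamma> (\<tau> i)) (\<gamma> (\<tau> (Suc i))) < \<delta>" using near[OF that, of "\<tau> (Suc i)"] by (simp add: \<tau>_Suc)
    then show "\<bar>Re (\<gamma> (\<tau> i)) - Re (\<gamma> (\<tau> (Suc i)))\<bar> < \<delta>" "\<bar>Im (\<gamma> (\<tau> i)) - Im (\<gamma> (\<tau> (Suc i)))\<bar> < \<delta>"
      using abs_Re_le_cmod[of "\<gamma> (\<tau> i) - \<gamma> (\<tau> (Suc i))"] abs_Im_le_cmod[of "\<gamma> (\<tau> i) - \<gamma> (\<tau> (Suc i))"]
      by (auto simp: dist_norm)
  qed
  have steps: "grid_step (v i) (u i)" "grid_step (u i) (v (Suc i))" if "i < N" for i
    using fl_near[OF close(1)[OF that]] fl_near[OF close(2)[OF that]]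
    by (auto simp: grid_step_def u_def v_def)
  \<comment> \<open>All points of one step lie in this disc: their coordinates differ from those of the sample by less than \<open>2 * \<delta>\<close>.\<close>
  define D where "D i = ball (\<gamma> (\<tau> i)) (4 * \<delta>)" for i
  have DV: "D i \<subseteq> V" if "i < N" for i
    using V[OF \<tau>01[of i]] that by (simp add: D_def)
  have in_ball: "w \<in> D i" if "\<bar>Re w - Re (\<gamma> (\<tau> i))\<bar> < 2 * \<delta>" "\<bar>Im w - Im (\<gamma> (\<tau> i))\<bar> < 2 * \<delta>" for w i
    using that cmod_le[of "\<gamma> (\<tau> i) - w"] by (simp add: D_def dist_norm abs_minus_commute)
  have nodes: "grid_point \<delta> (v i) \<in> D i" "grid_point \<delta> (u i) \<in> D i" "grid_point \<delta> (v (Suc i)) \<in> D i"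
    if "i < N" for i
    using close[OF that] fl[of "Re (\<gamma> (\<tau> i))"] fl[of "Im (\<gamma> (\<tau> i))"]
      fl[of "Re (\<gamma> (\<tau> (Suc i)))"] fl[of "Im (\<gamma> (\<tau> (Suc i)))"]
    by (intro in_ball; simp add: grid_point_def u_def v_def abs_less_iff algebra_simps; linarith)+
  have arc: "\<gamma> ` {\<tau> i..\<tau> (Suc i)} \<subseteq> D i" if "i < N" for i
    using near[OF that] \<open>\<delta> > 0\<close> by (force simp: D_def)
  have edges: "grid_step p q \<and> path_image (edge_path \<delta> (p, q)) \<subseteq> V" if "(p, q) \<in> set (L N)" for p q
  proof -
    obtain i where "i < N" and i: "(p, q) = (v i, u i) \<or> (p, q) = (u i, v (Suc i))"
      using \<open>(p, q) \<in> set (L N)\<close> by (auto simp: L_def)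
    then have "grid_point \<delta> p \<in> D i" "grid_point \<delta> q \<in> D i" "grid_step p q"
      using nodes steps by auto
    then show ?thesis
      using closed_segment_subset[of _ "D i"] DV[OF \<open>i < N\<close>] by (force simp: path_image_edge_path D_def)
  qed
  have "mset (map fst (L k)) + {#v k#} = mset (map snd (L k)) + {#v 0#}" for k
  proof (induction k)
    case (Suc k)
    then show ?case by (simp add: L_Suc)
  qed (simp add: L_def)
  moreover have "v N = v 0"
    using \<gamma>(2) by (simp add: v_def \<tau>0 \<tau>N pathstart_def pathfinish_def)
  ultimately have bal: "mset (map fst (L N)) = mset (map snd (L N))"
    by (metis add_right_cancel)
  have int: "path_integral \<gamma> g = (\<Sum>e\<leftarrow>L N. path_integral (edge_path \<delta> e) g)"
    if g: "C1_holomorphic_on g V" for g :: "complex \<Rightarrow> 'a"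
  proof -
    \<comment> \<open>The segment from the grid corner back to the curve. It depends on the sample only, which makes the sum telescope.\<close>
    define spur where "spur i = path_integral (linepath (grid_point \<delta> (v i)) (\<gamma> (\<tau> i))) g" for i
    let ?f = "\<lambda>t. vector_derivative \<gamma> (at t within {0..1}) *\<^sub>C g (\<gamma> t)"
    have "(?f has_integral ((\<Sum>e\<leftarrow>L k. path_integral (edge_path \<delta> e) g) + spur k - spur 0)) {0..\<tau> k}"
      if "k \<le> N" for k
      using that
    proof (induction k)
      case 0
      show ?case by (simp add: L_def \<tau>0 has_integral_refl)
    next
      case (Suc k)
      then have k: "k < N" by simp
      have "convex (D k)" by (simp add: D_def)
      obtain F where F: "\<And>z. z \<in> D k \<Longrightarrow> (F has_derivative (\<lambda>h. h *\<^sub>C g z)) (at z within D k)"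
        using primitive_on_convex[OF g DV[OF k] \<open>convex (D k)\<close>] by blast
      have seg: "path_integral (linepath x y) g = F y - F x" if "x \<in> D k" "y \<in> D k" for x y
        using that F by (intro path_integral_linepath_primitive[OF \<open>convex (D k)\<close>]) auto
      have ends: "\<gamma> (\<tau> k) \<in> D k" "\<gamma> (\<tau> (Suc k)) \<in> D k"
        using arc[OF k] by (auto simp: \<tau>_Suc)
      have "(?f has_integral (F (\<gamma> (\<tau> (Suc k))) - F (\<gamma> (\<tau> k)))) {\<tau> k..\<tau> (Suc k)}"
        using \<tau>01[of k] \<tau>01[of "Suc k"] k arc[OF k] F
        by (intro has_integral_along_path_primitive[OF \<gamma>(1), where S = "D k"]) (auto simp: \<tau>_Suc)
      then have "(?f has_integral ((\<Sum>e\<leftarrow>L k. path_integral (edge_path \<delta> e) g) + spur k - spur 0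
           + (F (\<gamma> (\<tau> (Suc k))) - F (\<gamma> (\<tau> k))))) {0..\<tau> (Suc k)}"
        using Suc k \<tau>01[of k] by (intro has_integral_combine[where c = "\<tau> k"]) (auto simp: \<tau>_Suc)
      moreover have "(\<Sum>e\<leftarrow>L k. path_integral (edge_path \<delta> e) g) + spur k - spur 0
           + (F (\<gamma> (\<tau> (Suc k))) - F (\<gamma> (\<tau> k)))
         = (\<Sum>e\<leftarrow>L (Suc k). path_integral (edge_path \<delta> e) g) + spur (Suc k) - spur 0"
        using nodes[OF k] ends by (simp add: L_Suc spur_def edge_path_def seg)
      ultimately show ?case by simp
    qed
    from this[of N] show ?thesis
      using \<open>v N = v 0\<close> \<gamma>(2)
      by (simp add: path_integral_def integral_unique \<tau>N spur_def \<tau>0 pathstart_def pathfinish_def)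
  qed
  show thesis using that[OF edges bal int] .
qed

lemma cycle_grid_approximation:
  fixes V :: "complex set"
  assumes "cycle_in \<Gamma> V" and "\<delta> > 0"
    and V: "\<And>\<gamma> z. \<gamma> \<in> set \<Gamma> \<Longrightarrow> z \<in> path_image \<gamma> \<Longrightarrow> ball z (4 * \<delta>) \<subseteq> V"
  shows "\<exists>L. (\<forall>p q. (p, q) \<in> set L \<longrightarrow> grid_step p q \<and> path_image (edge_path \<delta> (p, q)) \<subseteq> V)
    \<and> mset (map fst L) = mset (map snd L)
    \<and> (\<forall>g :: complex \<Rightarrow> 'a::complex_banach. C1_holomorphic_on g V \<longrightarrow>
           cycle_integral \<Gamma> g = (\<Sum>e\<leftarrow>L. path_integral (edge_path \<delta> e) g))"
  using assms
proof (induction \<Gamma>)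
  case (Cons \<gamma> \<Gamma>)
  have "\<exists>L. (\<forall>p q. (p, q) \<in> set L \<longrightarrow> grid_step p q \<and> path_image (edge_path \<delta> (p, q)) \<subseteq> V)
    \<and> mset (map fst L) = mset (map snd L)
    \<and> (\<forall>g :: complex \<Rightarrow> 'a::complex_banach. C1_holomorphic_on g V \<longrightarrow>
           cycle_integral \<Gamma> g = (\<Sum>e\<leftarrow>L. path_integral (edge_path \<delta> e) g))"
    using Cons.prems by (intro Cons.IH) (auto simp: cycle_in_def)
  then obtain L where L: "\<And>p q. (p, q) \<in> set L \<Longrightarrow> grid_step p q \<and> path_image (edge_path \<delta> (p, q)) \<subseteq> V"
    "mset (map fst L) = mset (map snd L)"
    "\<And>g :: complex \<Rightarrow> 'a. C1_holomorphic_on g V \<Longrightarrow>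
           cycle_integral \<Gamma> g = (\<Sum>e\<leftarrow>L. path_integral (edge_path \<delta> e) g)"
    by blast
  have "valid_path \<gamma>" "pathfinish \<gamma> = pathstart \<gamma>"
    using Cons.prems by (simp_all add: cycle_in_def)
  moreover have "ball (\<gamma> t) (4 * \<delta>) \<subseteq> V" if "t \<in> {0..1}" for t
    using Cons.prems(3)[of \<gamma> "\<gamma> t"] that by (simp add: path_image_def)
  ultimately obtain L' where L': "\<And>p q. (p, q) \<in> set L' \<Longrightarrow> grid_step p q \<and> path_image (edge_path \<delta> (p, q)) \<subseteq> V"
    "mset (map fst L') = mset (map snd L')"
    "\<And>g :: complex \<Rightarrow> 'a. C1_holomorphic_on g V \<Longrightarrow>
           path_integral \<gamma> g = (\<Sum>e\<leftarrow>L'. path_integral (edge_path \<delta> e) g)"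
    using path_grid_approximation[OF _ _ \<open>\<delta> > 0\<close>] by metis
  show ?case
    by (rule exI[of _ "L' @ L"]) (use L L' in \<open>auto simp: cycle_integral_eq\<close>)
qed (auto intro!: exI[of _ "[]"] simp: cycle_integral_eq)

section \<open>Integrals over homologous cycles\<close>

lemma winding_swap:
  assumes "z \<notin> path_image (edge_path \<delta> (p, q))"
  shows "winding_number (edge_path \<delta> (q, p)) z = - winding_number (edge_path \<delta> (p, q)) z"
  using winding_number_reversepath[of "edge_path \<delta> (p, q)" z] assms by (simp add: edge_path_def)

text \<open>
  The value zero on edges through \<open>z\<close> keeps the weight antisymmetric there as well.
\<close>
definition winding_weight :: "real \<Rightarrow> complex \<Rightarrow> edge \<Rightarrow> complex" where
  "winding_weight \<delta> z e = (if z \<in> path_image (edge_path \<delta> e) then 0 else winding_number (edge_path \<delta> e) z)"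

lemma antisymmetric_winding_weight: "antisymmetric (winding_weight \<delta> z)"
proof -
  have img: "path_image (edge_path \<delta> (q, p)) = path_image (edge_path \<delta> (p, q))" for p q
    by (simp add: path_image_edge_path closed_segment_commute)
  show ?thesis
    unfolding antisymmetric_def winding_weight_def img by (auto simp: winding_swap)
qed

lemma winding_weight_eq:
  assumes "\<delta> > 0" "z \<in> grid_cell \<delta> s" "grid_step (fst e) (snd e)"
  shows "winding_weight \<delta> z e = winding_number (edge_path \<delta> e) z"
  using grid_cell_avoids_edges[OF assms] by (simp add: winding_weight_def)

lemma sum_winding_weight_eq:
  assumes "\<delta> > 0" "z \<in> grid_cell \<delta> s" "\<And>p q. (p, q) \<in> set L \<Longrightarrow> grid_step p q"
  shows "(\<Sum>e\<leftarrow>L. winding_weight \<delta> z e) = (\<Sum>e\<leftarrow>L. winding_number (edge_path \<delta> e) z)"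
  using assms(3)
  by (intro arg_cong[where f = sum_list] map_cong refl winding_weight_eq[OF assms(1,2)])
     (metis prod.collapse)

text \<open>
  The combinatorial multiplicity is the analytic winding number: the boundary of a square winds once around the
  points of its own cell and not at all around the points of other cells.
\<close>
lemma grid_cycle_winding:
  fixes \<delta> :: real
  assumes "\<delta> > 0"
    and L: "\<And>p q. (p, q) \<in> set L \<Longrightarrow> grid_step p q \<and> p \<in> {B..C} \<times> {B..C} \<and> q \<in> {B..C} \<times> {B..C}"
    and bal: "mset (map fst L) = mset (map snd L)"
    and s: "s \<in> {B..C} \<times> {B..C}" and z: "z \<in> grid_square \<delta> s"
    and off: "\<And>e. e \<in> set L \<Longrightarrow> z \<notin> path_image (edge_path \<delta> e)"
  shows "(\<Sum>e\<leftarrow>L. winding_number (edge_path \<delta> e) z) = of_real (winding_coeff B L s)"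
proof (rule winding_on_closed_square[OF \<open>\<delta> > 0\<close> _ z off])
  fix z assume z: "z \<in> grid_cell \<delta> s"
  note weight = sum_winding_weight_eq[OF \<open>\<delta> > 0\<close> z]
  have "(\<Sum>e\<leftarrow>L. winding_number (edge_path \<delta> e) z) = (\<Sum>e\<leftarrow>L. winding_weight \<delta> z e)"
    using L by (intro weight[symmetric]) blast
  also have "\<dots> = (\<Sum>s'\<in>{B..C} \<times> {B..C}. winding_coeff B L s' *\<^sub>R (\<Sum>e\<leftarrow>square_boundary s'. winding_weight \<delta> z e))"
    by (rule grid_cycle_eq_sum_squares[OF antisymmetric_winding_weight L bal])
  also have "\<dots> = (\<Sum>s'\<in>{B..C} \<times> {B..C}. winding_coeff B L s' *\<^sub>R (if s' = s then 1 else 0))"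
    using weight grid_step_square_boundary
    by (simp add: winding_square_boundary[OF \<open>\<delta> > 0\<close> z])
  also have "\<dots> = (\<Sum>s'\<in>{s}. winding_coeff B L s' *\<^sub>R 1)"
    using s by (intro sum.mono_neutral_cong_right) auto
  finally show "(\<Sum>e\<leftarrow>L. winding_number (edge_path \<delta> e) z) = of_real (winding_coeff B L s)"
    by (simp add: scaleR_conv_of_real)
qed

lemma sum_list_scaleC: "(\<Sum>x\<leftarrow>xs. f x *\<^sub>C v) = (\<Sum>x\<leftarrow>xs. f x) *\<^sub>C v"
  by (induction xs) (simp_all add: scaleC_add_left scaleC.zero_left)

lemma grid_box_exists:
  fixes L :: "edge list"
  obtains B C where "\<And>p q. (p, q) \<in> set L \<Longrightarrow> p \<in> {B..C} \<times> {B..C} \<and> q \<in> {B..C} \<times> {B..C}"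
proof -
  define X where "X = (\<Union>e\<in>set L. {fst (fst e), snd (fst e), fst (snd e), snd (snd e)})"
  have "finite X" by (simp add: X_def)
  then obtain B C where "\<forall>x\<in>X. B \<le> x" "\<forall>x\<in>X. x \<le> C"
    using bdd_below_finite bdd_above_finite unfolding bdd_below_def bdd_above_def by meson
  then show thesis
    by (intro that[of B C]) (force simp: X_def mem_Times_iff)
qed

text \<open>
  The homology form of Cauchy's theorem, for vector-valued integrands, by Artin's argument. Both cycles are
  pushed onto the same grid; the difference \<open>L\<close> of the two grid cycles is a combination of
  square boundaries. A square that contains a point outside \<open>V\<close> has multiplicity zero, because
  around that point the two cycles wind equally often. All other squares lie in \<open>V\<close>, where the
  integrand has a primitive on the square and hence integral zero over its boundary.
\<close>
theorem homologous_cycles_integral_eq: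
  fixes g :: "complex \<Rightarrow> 'a::complex_banach"
  assumes "open V" and \<Gamma>: "cycle_in \<Gamma>1 V" "cycle_in \<Gamma>2 V"
    and wind: "\<And>z. z \<notin> V \<Longrightarrow> cycle_winding_number \<Gamma>1 z = cycle_winding_number \<Gamma>2 z"
    and g: "C1_holomorphic_on g V"
  shows "cycle_integral \<Gamma>1 g = cycle_integral \<Gamma>2 g"
proof (cases "\<exists>v::'a. v \<noteq> 0")
  case False
  then show ?thesis by metis
next
  case True
  \<comment> \<open>A nonzero vector lets integrals of poles detect winding numbers in the value space itself.\<close>
  then obtain v :: 'a where "v \<noteq> 0" by blast
  define T where "T = (\<Union>\<gamma>\<in>set (\<Gamma>1 @ \<Gamma>2). path_image \<gamma>)"
  have "compact T" "T \<subseteq> V"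
    using \<Gamma> by (auto simp: T_def cycle_in_def intro!: compact_UN compact_path_image valid_path_imp_path)
  then obtain \<epsilon> where "\<epsilon> > 0" and \<epsilon>: "(\<Union>x\<in>T. ball x \<epsilon>) \<subseteq> V"
    using compact_subset_open_imp_ball_epsilon_subset \<open>open V\<close> by metis
  define \<delta> where "\<delta> = \<epsilon> / 4"
  have "\<delta> > 0" and \<epsilon>_eq: "4 * \<delta> = \<epsilon>" using \<open>\<epsilon> > 0\<close> by (simp_all add: \<delta>_def)
  have balls: "ball z (4 * \<delta>) \<subseteq> V" if "\<gamma> \<in> set (\<Gamma>1 @ \<Gamma>2)" "z \<in> path_image \<gamma>" for \<gamma> z
    using \<epsilon> that unfolding \<epsilon>_eq T_def by blast
  define approx where "approx \<Gamma> L \<longleftrightarrow> (\<forall>p q. (p, q) \<in> set L \<longrightarrow> grid_step p q \<and> path_image (edge_path \<delta> (p, q)) \<subseteq> V)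
    \<and> mset (map fst L) = mset (map snd L)
    \<and> (\<forall>g :: complex \<Rightarrow> 'a. C1_holomorphic_on g V \<longrightarrow>
           cycle_integral \<Gamma> g = (\<Sum>e\<leftarrow>L. path_integral (edge_path \<delta> e) g))" for \<Gamma> L
  have approx_image: "path_image (edge_path \<delta> e) \<subseteq> V" if "approx \<Gamma> L" "e \<in> set L" for \<Gamma> L e
    using that unfolding approx_def by (metis prod.collapse)
  have "\<exists>L. approx \<Gamma>1 L" unfolding approx_def
    by (rule cycle_grid_approximation[OF \<Gamma>(1) \<open>\<delta> > 0\<close>]) (use balls in auto)
  then obtain L1 where L1: "approx \<Gamma>1 L1" ..
  have "\<exists>L. approx \<Gamma>2 L" unfolding approx_def
    by (rule cycle_grid_approximation[OF \<Gamma>(2) \<open>\<delta> > 0\<close>]) (use balls in auto)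
  then obtain L2 where L2: "approx \<Gamma>2 L2" ..
  have wind_approx: "cycle_winding_number \<Gamma> z = (\<Sum>e\<leftarrow>L. winding_number (edge_path \<delta> e) z)"
    if L: "approx \<Gamma> L" and "cycle_in \<Gamma> V" and "z \<notin> V" for \<Gamma> L z
  proof -
    let ?c = "2 * of_real pi * \<i> :: complex" and ?p = "\<lambda>w. (1 / (w - z)) *\<^sub>C v"
    have "cycle_integral \<Gamma> ?p = (\<Sum>\<gamma>\<leftarrow>\<Gamma>. (?c * winding_number \<gamma> z) *\<^sub>C v)"
      unfolding cycle_integral_eq using that(2,3)
      by (intro arg_cong[where f = sum_list] map_cong refl path_integral_pole) (auto simp: cycle_in_def)
    moreover have "(\<Sum>e\<leftarrow>L. path_integral (edge_path \<delta> e) ?p) = (\<Sum>e\<leftarrow>L. (?c * winding_number (edge_path \<delta> e) z) *\<^sub>C v)"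
      using approx_image[OF L] \<open>z \<notin> V\<close>
      by (intro arg_cong[where f = sum_list] map_cong refl path_integral_pole valid_path_edge_path) blast
    moreover have "cycle_integral \<Gamma> ?p = (\<Sum>e\<leftarrow>L. path_integral (edge_path \<delta> e) ?p)"
      using L C1_holomorphic_on_pole[OF \<open>z \<notin> V\<close>, of v] unfolding approx_def by blast
    ultimately have "(?c * cycle_winding_number \<Gamma> z - ?c * (\<Sum>e\<leftarrow>L. winding_number (edge_path \<delta> e) z)) *\<^sub>C v = 0"
      by (simp add: sum_list_scaleC sum_list_const_mult cycle_winding_number_def scaleC.diff_left)
    then show ?thesis using \<open>v \<noteq> 0\<close> by simp
  qed
  \<comment> \<open>The formal difference of the two grid cycles.\<close>
  define L where "L = L1 @ map prod.swap L2"
  have inV: "path_image (edge_path \<delta> e) \<subseteq> V" if "e \<in> set L" for e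
  proof -
    have "e \<in> set L1 \<or> prod.swap e \<in> set L2" using that by (auto simp: L_def)
    then show ?thesis
      using approx_image[OF L1, of e] approx_image[OF L2, of "prod.swap e"]
      by (auto simp only: path_image_edge_path closed_segment_commute fst_swap snd_swap)
  qed
  have step: "grid_step p q" if "(p, q) \<in> set L" for p q
  proof -
    have "(p, q) \<in> set L1 \<or> (q, p) \<in> set L2" using that by (auto simp: L_def)
    then have "grid_step p q \<or> grid_step q p" using L1 L2 unfolding approx_def by blast
    then show ?thesis unfolding grid_step_def by (auto simp: abs_minus_commute)
  qed
  have bal: "mset (map fst L) = mset (map snd L)"
    using L1 L2 by (simp add: L_def approx_def o_def)
  have sum_swap: "(\<Sum>e\<leftarrow>L. w e) = (\<Sum>e\<leftarrow>L1. w e) - (\<Sum>e\<leftarrow>L2. w e)"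
    if "\<And>e. e \<in> set L2 \<Longrightarrow> w (prod.swap e) = - w e" for w :: "edge \<Rightarrow> 'b::real_vector"
  proof -
    have "(\<Sum>e\<leftarrow>L2. w (prod.swap e)) = (\<Sum>e\<leftarrow>L2. - w e)"
      using that by (intro arg_cong[where f = sum_list] map_cong) auto
    then show ?thesis by (simp add: L_def o_def uminus_sum_list_map[unfolded o_def, symmetric])
  qed
  have wind0: "(\<Sum>e\<leftarrow>L. winding_number (edge_path \<delta> e) z) = 0" if "z \<notin> V" for z
  proof -
    have "(\<Sum>e\<leftarrow>L. winding_number (edge_path \<delta> e) z) =
        (\<Sum>e\<leftarrow>L1. winding_number (edge_path \<delta> e) z) - (\<Sum>e\<leftarrow>L2. winding_number (edge_path \<delta> e) z)"
    proof (rule sum_swap)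
      fix e assume "e \<in> set L2"
      then have "z \<notin> path_image (edge_path \<delta> (fst e, snd e))"
        using L2 \<open>z \<notin> V\<close> unfolding approx_def by (metis prod.collapse subsetD)
      from winding_swap[OF this]
      show "winding_number (edge_path \<delta> (prod.swap e)) z = - winding_number (edge_path \<delta> e) z"
        by (simp add: prod.swap_def)
    qed
    then show ?thesis
      using wind_approx[OF L1 \<Gamma>(1) that] wind_approx[OF L2 \<Gamma>(2) that] wind[OF that] by simp
  qed
  obtain B C where BC: "\<And>p q. (p, q) \<in> set L \<Longrightarrow> p \<in> {B..C} \<times> {B..C} \<and> q \<in> {B..C} \<times> {B..C}"
    using grid_box_exists by blast
  \<comment> \<open>Around a point of the square outside \<open>V\<close> the multiplicity would be the difference of two equal winding numbers.\<close>
  have sq: "grid_square \<delta> s \<subseteq> V" if "s \<in> {B..C} \<times> {B..C}" "winding_coeff B L s \<noteq> 0" for s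
  proof
    fix z assume z: "z \<in> grid_square \<delta> s"
    show "z \<in> V"
    proof (rule ccontr)
      assume "z \<notin> V"
      have "(\<Sum>e\<leftarrow>L. winding_number (edge_path \<delta> e) z) = of_real (winding_coeff B L s)"
      proof (rule grid_cycle_winding[OF \<open>\<delta> > 0\<close> _ bal that(1) z])
        show "z \<notin> path_image (edge_path \<delta> e)" if "e \<in> set L" for e
          using inV[OF that] \<open>z \<notin> V\<close> by blast
      qed (use step BC in blast)
      then show False using wind0[OF \<open>z \<notin> V\<close>] that(2) by simp
    qed
  qed
  define w where "w e = (if path_image (edge_path \<delta> e) \<subseteq> V then path_integral (edge_path \<delta> e) g else 0)" for e
  have anti: "antisymmetric w"
    unfolding antisymmetric_def
  proof (intro allI)
    fix p q
    let ?S = "closed_segment (grid_point \<delta> p) (grid_point \<delta> q)"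
    show "w (q, p) = - w (p, q)"
    proof (cases "?S \<subseteq> V")
      case True
      obtain F where F: "\<And>z. z \<in> ?S \<Longrightarrow> (F has_derivative (\<lambda>h. h *\<^sub>C g z)) (at z within ?S)"
        using primitive_on_convex[OF g True] by auto
      have "path_integral (linepath x y) g = F y - F x" if "x \<in> ?S" "y \<in> ?S" for x y
        using that F by (intro path_integral_linepath_primitive[of ?S]) auto
      then show ?thesis
        using True by (simp add: w_def path_image_edge_path closed_segment_commute) (simp add: edge_path_def)
    qed (simp add: w_def path_image_edge_path closed_segment_commute)
  qed
  have "(\<Sum>e\<leftarrow>square_boundary s. w e) = 0" if "grid_square \<delta> s \<subseteq> V" for s
  proof -
    obtain F where F: "\<And>z. z \<in> grid_square \<delta> s \<Longrightarrow>
        (F has_derivative (\<lambda>h. h *\<^sub>C g z)) (at z within grid_square \<delta> s)"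
      using primitive_on_convex[OF g \<open>grid_square \<delta> s \<subseteq> V\<close> convex_grid_square] by blast
    have "w e = F (grid_point \<delta> (snd e)) - F (grid_point \<delta> (fst e))" if "e \<in> set (square_boundary s)" for e
    proof -
      have "path_image (edge_path \<delta> e) \<subseteq> grid_square \<delta> s"
        using square_boundary_subset[OF that \<open>\<delta> > 0\<close>] .
      moreover have "grid_point \<delta> (fst e) \<in> path_image (edge_path \<delta> e)" "grid_point \<delta> (snd e) \<in> path_image (edge_path \<delta> e)"
        by (simp_all add: path_image_edge_path)
      ultimately show ?thesis
        using \<open>grid_square \<delta> s \<subseteq> V\<close> F
          path_integral_linepath_primitive[OF convex_grid_square, of "grid_point \<delta> (fst e)" \<delta> s "grid_point \<delta> (snd e)" F g]
        by (auto simp: w_def edge_path_def)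
    qed
    then have "(\<Sum>e\<leftarrow>square_boundary s. w e) =
        (\<Sum>e\<leftarrow>square_boundary s. F (grid_point \<delta> (snd e)) - F (grid_point \<delta> (fst e)))"
      by (intro arg_cong[where f = sum_list] map_cong) auto
    also have "\<dots> = 0" by (simp add: square_boundary_def split: prod.splits)
    finally show ?thesis .
  qed
  then have "(\<Sum>s\<in>{B..C} \<times> {B..C}. winding_coeff B L s *\<^sub>R (\<Sum>e\<leftarrow>square_boundary s. w e)) = 0"
    using sq by (intro sum.neutral ballI) (metis scale_eq_0_iff)
  then have "(\<Sum>e\<leftarrow>L. w e) = 0"
    using grid_cycle_eq_sum_squares[OF anti _ bal, of B C] step BC by auto
  moreover have "(\<Sum>e\<leftarrow>L. w e) = (\<Sum>e\<leftarrow>L1. w e) - (\<Sum>e\<leftarrow>L2. w e)"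
    using antisymmetricD[OF anti] by (intro sum_swap) (metis prod.swap_def prod.collapse)
  moreover have "(\<Sum>e\<leftarrow>L'. w e) = cycle_integral \<Gamma> g" if "approx \<Gamma> L'" for \<Gamma> L'
  proof -
    have "(\<Sum>e\<leftarrow>L'. w e) = (\<Sum>e\<leftarrow>L'. path_integral (edge_path \<delta> e) g)"
      using that by (intro arg_cong[where f = sum_list] map_cong) (use approx_image[OF that] in \<open>auto simp: w_def\<close>)
    then show ?thesis using that g by (simp add: approx_def)
  qed
  ultimately show ?thesis using L1 L2 by simp
qed

section \<open>Cycles surrounding a compact set\<close>

text \<open>
  Paths whose initial and final points agree as multisets can be linked up to closed paths: if the
  first path is not closed, then its end is the beginning of another one, and joining the two
  leaves a shorter list with the same property.
\<close>
lemma balanced_paths_form_cycle: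
  assumes "\<And>\<gamma>. \<gamma> \<in> set L \<Longrightarrow> valid_path \<gamma> \<and> path_image \<gamma> \<subseteq> T"
    and "mset (map pathstart L) = mset (map pathfinish L)"
  shows "\<exists>\<Gamma>. cycle_in \<Gamma> T \<and> (\<forall>z. z \<notin> T \<longrightarrow> cycle_winding_number \<Gamma> z = (\<Sum>\<gamma>\<leftarrow>L. winding_number \<gamma> z))"
  using assms
proof (induction "length L" arbitrary: L rule: less_induct)
  case less
  show ?case
  proof (cases L)
    case Nil
    then show ?thesis by (intro exI[of _ "[]"]) (simp add: cycle_in_def cycle_winding_number_def)
  next
    case (Cons \<gamma> L')
    show ?thesis
    proof (cases "pathfinish \<gamma> = pathstart \<gamma>")
      case True
      obtain \<Gamma> where "cycle_in \<Gamma> T"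
        "\<And>z. z \<notin> T \<Longrightarrow> cycle_winding_number \<Gamma> z = (\<Sum>\<gamma>\<leftarrow>L'. winding_number \<gamma> z)"
        using less.hyps[of L'] less.prems True Cons by auto
      then show ?thesis
        using True less.prems(1) Cons
        by (intro exI[of _ "\<gamma> # \<Gamma>"]) (auto simp: cycle_in_def cycle_winding_number_def)
    next
      case False
      have "pathfinish \<gamma> \<in># mset (map pathstart L)"
        unfolding less.prems(2) by (simp add: Cons)
      then obtain \<eta> where "\<eta> \<in> set L'" and \<eta>: "pathstart \<eta> = pathfinish \<gamma>"
        using False Cons by auto
      then obtain xs ys where L': "L' = xs @ \<eta> # ys"
        by (meson split_list)
      define L'' where "L'' = (\<gamma> +++ \<eta>) # xs @ ys"
      have p: "valid_path \<gamma>" "valid_path \<eta>" "path_image \<gamma> \<subseteq> T" "path_image \<eta> \<subseteq> T"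
        using less.prems(1) by (auto simp: Cons L')
      have "valid_path \<xi> \<and> path_image \<xi> \<subseteq> T" if "\<xi> \<in> set L''" for \<xi>
      proof (cases "\<xi> = \<gamma> +++ \<eta>")
        case True
        then show ?thesis using p \<eta> by (simp add: valid_path_join path_image_join)
      next
        case False
        then show ?thesis using that less.prems(1) by (auto simp: L''_def Cons L')
      qed
      moreover have "mset (map pathstart L'') = mset (map pathfinish L'')"
        using less.prems(2) by (simp add: L''_def Cons L' \<eta>)
      ultimately obtain \<Gamma> where \<Gamma>: "cycle_in \<Gamma> T"
        "\<And>z. z \<notin> T \<Longrightarrow> cycle_winding_number \<Gamma> z = (\<Sum>\<gamma>\<leftarrow>L''. winding_number \<gamma> z)"
        using less.hyps[of L''] by (auto simp: Cons L' L''_def)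
      moreover have "(\<Sum>\<gamma>\<leftarrow>L''. winding_number \<gamma> z) = (\<Sum>\<gamma>\<leftarrow>L. winding_number \<gamma> z)" if "z \<notin> T" for z
      proof -
        have "z \<notin> path_image \<gamma>" "z \<notin> path_image \<eta>" using that p by auto
        then show ?thesis
          using p \<eta> by (simp add: L''_def Cons L' winding_number_join valid_path_imp_path)
      qed
      ultimately show ?thesis by auto
    qed
  qed
qed

lemma square_boundary_disjoint:
  "e \<in> set (square_boundary s) \<Longrightarrow> e \<in> set (square_boundary s') \<Longrightarrow> s = s'"
  by (cases s; cases s') (auto simp: square_boundary_def)

lemma distinct_square_boundary: "distinct (square_boundary s)"
  by (cases s) (simp add: square_boundary_def)

lemma swap_in_square_boundary:
  assumes "e \<in> set (square_boundary s)"
  obtains s' where "prod.swap e \<in> set (square_boundary s')"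
proof -
  obtain m n where s: "s = (m, n)" by (cases s)
  have "prod.swap e \<in> set (square_boundary (m, n - 1)) \<or> prod.swap e \<in> set (square_boundary (m + 1, n))
     \<or> prod.swap e \<in> set (square_boundary (m, n + 1)) \<or> prod.swap e \<in> set (square_boundary (m - 1, n))"
    using assms by (auto simp: s square_boundary_def)
  then show thesis using that by blast
qed

text \<open>
  The edges that remain of the sum of the boundaries of the squares in \<open>S\<close> when opposite edges of neighbouring
  squares are cancelled.
\<close>
definition outer_edges :: "(int \<times> int) set \<Rightarrow> edge set" where
  "outer_edges S = {e \<in> \<Union>s\<in>S. set (square_boundary s). prod.swap e \<notin> (\<Union>s\<in>S. set (square_boundary s))}"

lemma finite_outer_edges: "finite S \<Longrightarrow> finite (outer_edges S)"
  by (simp add: outer_edges_def)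

text \<open>
  The cancelled edges form a set that is closed under reversal, and on such a set an
  antisymmetric weight sums up to its own negative.
\<close>
lemma sum_outer_edges:
  assumes "finite S" and anti: "antisymmetric w"
  shows "(\<Sum>e\<in>outer_edges S. w e) = (\<Sum>s\<in>S. \<Sum>e\<leftarrow>square_boundary s. w e)"
proof -
  define D where "D = (\<Union>s\<in>S. set (square_boundary s))"
  define X where "X = {e \<in> D. prod.swap e \<in> D}"
  have "finite D" using assms by (simp add: D_def)
  have outer: "outer_edges S = D - X" by (auto simp: outer_edges_def D_def X_def)
  have "(\<Sum>e\<in>X. w e) = (\<Sum>e\<in>X. w (prod.swap e))"
    by (rule sum.reindex_bij_witness[of _ prod.swap prod.swap]) (auto simp: X_def)
  also have "\<dots> = (\<Sum>e\<in>X. - w e)"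
    using antisymmetricD[OF anti] by (intro sum.cong refl) (metis prod.swap_def prod.collapse)
  finally have "(\<Sum>e\<in>X. w e) = 0"
    by (intro eq_uminus_self_imp_0) (simp add: sum_negf)
  then have "(\<Sum>e\<in>outer_edges S. w e) = (\<Sum>e\<in>D. w e)"
    using \<open>finite D\<close> sum_diff[of D X w] by (simp add: outer X_def)
  also have "\<dots> = (\<Sum>s\<in>S. \<Sum>e\<in>set (square_boundary s). w e)"
    unfolding D_def using assms(1) square_boundary_disjoint
    by (intro sum.UNION_disjoint) (blast | simp)+
  also have "\<dots> = (\<Sum>s\<in>S. \<Sum>e\<leftarrow>square_boundary s. w e)"
    by (intro sum.cong refl sum_list_distinct_conv_sum_set[symmetric] distinct_square_boundary)
  finally show ?thesis .
qed

lemma count_mset_eq_sum_list: "real (count (mset xs) x) = (\<Sum>y\<leftarrow>xs. if y = x then 1 else 0)"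
  by (induction xs) auto

text \<open>
  For a fixed vertex \<open>x\<close>, the weight that counts entering minus leaving edges is antisymmetric and
  vanishes on the boundary of every square, hence also on the outer edges.
\<close>
lemma outer_edges_balanced:
  assumes "finite S" "set L = outer_edges S" "distinct L"
  shows "mset (map fst L) = mset (map snd L)"
proof (rule multiset_eqI)
  fix x
  define w :: "edge \<Rightarrow> real" where
    "w e = (if snd e = x then 1 else 0) - (if fst e = x then 1 else 0)" for e
  have "(\<Sum>e\<leftarrow>L. w e) = (\<Sum>e\<in>outer_edges S. w e)"
    using assms by (simp add: sum_list_distinct_conv_sum_set)
  also have "\<dots> = (\<Sum>s\<in>S. \<Sum>e\<leftarrow>square_boundary s. w e)"
    by (rule sum_outer_edges[OF assms(1)]) (simp add: antisymmetric_def w_def)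
  also have "\<dots> = 0"
    by (intro sum.neutral ballI) (simp add: square_boundary_def w_def split: prod.splits)
  finally have "(\<Sum>e\<leftarrow>L. if snd e = x then 1 else (0::real)) = (\<Sum>e\<leftarrow>L. if fst e = x then 1 else 0)"
    by (simp add: w_def sum_list_subtractf)
  then have "real (count (mset (map fst L)) x) = real (count (mset (map snd L)) x)"
    by (simp only: count_mset_eq_sum_list map_map o_def)
  then show "count (mset (map fst L)) x = count (mset (map snd L)) x" by simp
qed

lemma finite_grid_squares_meeting_bounded:
  assumes "\<delta> > 0" "bounded K"
  shows "finite {s. grid_square \<delta> s \<inter> K \<noteq> {}}"
proof -
  obtain R where R: "\<And>z. z \<in> K \<Longrightarrow> norm z \<le> R"
    using \<open>bounded K\<close> by (auto simp: bounded_iff)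
  \<comment> \<open>One extra row, because a square left of the range can still touch it with its right side.\<close>
  define k where "k = \<lceil>R / \<delta>\<rceil> + 1"
  have bound: "i \<in> {-k..k}" if "\<delta> * of_int i \<le> x" "x \<le> \<delta> * (of_int i + 1)" "\<bar>x\<bar> \<le> R" for i x
  proof -
    have "of_int i \<le> x / \<delta>" "x / \<delta> \<le> of_int i + 1" "\<bar>x / \<delta>\<bar> \<le> R / \<delta>"
      using that \<open>\<delta> > 0\<close> by (simp_all add: pos_le_divide_eq pos_divide_le_eq mult.commute abs_divide)
    then show ?thesis unfolding k_def by (simp; linarith)
  qed
  have "{s. grid_square \<delta> s \<inter> K \<noteq> {}} \<subseteq> {-k..k} \<times> {-k..k}"
  proof
    fix s assume "s \<in> {s. grid_square \<delta> s \<inter> K \<noteq> {}}"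
    then obtain z where z: "z \<in> grid_square \<delta> s" "z \<in> K" by blast
    then have "\<bar>Re z\<bar> \<le> R" "\<bar>Im z\<bar> \<le> R"
      using R[of z] abs_Re_le_cmod[of z] abs_Im_le_cmod[of z] by auto
    then show "s \<in> {-k..k} \<times> {-k..k}"
      using bound z(1) by (simp only: mem_Times_iff mem_grid_square atLeastAtMost_iff) blast
  qed
  then show ?thesis by (rule finite_subset) simp
qed

text \<open>
  Take the outer edges of all squares of a fine grid that meet \<open>K\<close>. An outer edge cannot meet \<open>K\<close>, for
  otherwise the squares on both of its sides would belong to the collection and the edge would
  have been cancelled. The sum of the square boundaries winds once around every point of the
  squares in the collection and not at all around other points.
\<close>
theorem surrounding_cycle_exists:
  assumes "compact K" "open U" "K \<subseteq> U"
  obtains \<Gamma> where "surrounds_in \<Gamma> K U"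
proof -
  obtain \<epsilon> where "\<epsilon> > 0" and \<epsilon>: "(\<Union>x\<in>K. ball x \<epsilon>) \<subseteq> U"
    using compact_subset_open_imp_ball_epsilon_subset assms by metis
  \<comment> \<open>Two points of one square differ by at most \<open>\<delta>\<close> in each coordinate, so by at most \<open>2 * \<delta> < \<epsilon>\<close>.\<close>
  define \<delta> where "\<delta> = \<epsilon> / 3"
  have "\<delta> > 0" using \<open>\<epsilon> > 0\<close> by (simp add: \<delta>_def)
  define S where "S = {s. grid_square \<delta> s \<inter> K \<noteq> {}}"
  have "finite S"
    unfolding S_def
    by (rule finite_grid_squares_meeting_bounded[OF \<open>\<delta> > 0\<close> compact_imp_bounded[OF \<open>compact K\<close>]])
  have SU: "grid_square \<delta> s \<subseteq> U" if "s \<in> S" for s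
  proof
    fix w assume w: "w \<in> grid_square \<delta> s"
    obtain z where z: "z \<in> grid_square \<delta> s" "z \<in> K" using \<open>s \<in> S\<close> unfolding S_def by blast
    have "\<bar>Re (z - w)\<bar> \<le> \<delta>" "\<bar>Im (z - w)\<bar> \<le> \<delta>"
      using w z(1) by (auto simp: mem_grid_square algebra_simps abs_le_iff)
    then have "norm (z - w) < \<epsilon>"
      using cmod_le[of "z - w"] \<open>\<epsilon> > 0\<close> by (simp add: \<delta>_def)
    then show "w \<in> U" using \<epsilon> z(2) by (auto simp: dist_norm subset_iff)
  qed
  obtain L where L: "set L = outer_edges S" "distinct L"
    using finite_distinct_list[OF finite_outer_edges[OF \<open>finite S\<close>]] by blast
  define T where "T = (\<Union>e\<in>outer_edges S. path_image (edge_path \<delta> e))"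
  have TU: "T \<subseteq> U"
    using SU square_boundary_subset[OF _ \<open>\<delta> > 0\<close>] unfolding T_def outer_edges_def by blast
  have TK: "T \<inter> K = {}"
  proof (rule ccontr)
    assume "T \<inter> K \<noteq> {}"
    then obtain z e where z: "z \<in> K" "z \<in> path_image (edge_path \<delta> e)" and e: "e \<in> outer_edges S"
      by (auto simp: T_def)
    obtain s where "e \<in> set (square_boundary s)"
      using e by (auto simp: outer_edges_def)
    then obtain s' where s': "prod.swap e \<in> set (square_boundary s')"
      by (rule swap_in_square_boundary)
    \<comment> \<open>The square on the other side of \<open>e\<close> contains \<open>z\<close> as well.\<close>
    have "z \<in> path_image (edge_path \<delta> (prod.swap e))"
      using z(2) by (simp add: path_image_edge_path closed_segment_commute)
    then have "z \<in> grid_square \<delta> s'"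
      using square_boundary_subset[OF s' \<open>\<delta> > 0\<close>] by blast
    then have "s' \<in> S" using z(1) by (auto simp: S_def)
    then show False using e s' by (auto simp: outer_edges_def)
  qed
  have step: "grid_step p q" if "(p, q) \<in> set L" for p q
  proof -
    obtain s where "(p, q) \<in> set (square_boundary s)"
      using \<open>(p, q) \<in> set L\<close> unfolding L(1) outer_edges_def by blast
    then show ?thesis by (rule grid_step_square_boundary)
  qed
  have wind: "(\<Sum>e\<leftarrow>L. winding_number (edge_path \<delta> e) z) = (if s \<in> S then 1 else 0)"
    if "z \<in> grid_square \<delta> s" "z \<notin> T" for z s
  proof (rule winding_on_closed_square[OF \<open>\<delta> > 0\<close> _ that(1)])
    fix z assume z: "z \<in> grid_cell \<delta> s"
    note weight = sum_winding_weight_eq[OF \<open>\<delta> > 0\<close> z]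
    have "(\<Sum>e\<leftarrow>L. winding_number (edge_path \<delta> e) z) = (\<Sum>e\<leftarrow>L. winding_weight \<delta> z e)"
      by (rule weight[symmetric]) (rule step)
    also have "\<dots> = (\<Sum>s'\<in>S. \<Sum>e\<leftarrow>square_boundary s'. winding_weight \<delta> z e)"
      using sum_outer_edges[OF \<open>finite S\<close> antisymmetric_winding_weight]
      by (simp add: sum_list_distinct_conv_sum_set L)
    also have "\<dots> = (\<Sum>s'\<in>S. if s' = s then 1 else 0)"
      using weight grid_step_square_boundary
      by (simp add: winding_square_boundary[OF \<open>\<delta> > 0\<close> z])
    finally show "(\<Sum>e\<leftarrow>L. winding_number (edge_path \<delta> e) z) = (if s \<in> S then 1 else 0)"
      using \<open>finite S\<close> by simp
  qed (use that(2) L in \<open>auto simp: T_def\<close>)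
  have "mset (map pathstart (map (edge_path \<delta>) L)) = mset (map pathfinish (map (edge_path \<delta>) L))"
  proof -
    have "mset (map pathstart (map (edge_path \<delta>) L)) = image_mset (grid_point \<delta>) (mset (map fst L))"
      by (simp add: edge_path_def o_def image_mset.compositionality)
    also have "\<dots> = mset (map pathfinish (map (edge_path \<delta>) L))"
      unfolding outer_edges_balanced[OF \<open>finite S\<close> L]
      by (simp add: edge_path_def o_def image_mset.compositionality)
    finally show ?thesis .
  qed
  then have "\<exists>\<Gamma>. cycle_in \<Gamma> T \<and> (\<forall>z. z \<notin> T \<longrightarrow>
      cycle_winding_number \<Gamma> z = (\<Sum>\<gamma>\<leftarrow>map (edge_path \<delta>) L. winding_number \<gamma> z))"
    by (rule balanced_paths_form_cycle[rotated]) (auto simp: T_def L)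
  then obtain \<Gamma> where \<Gamma>: "cycle_in \<Gamma> T"
    "\<And>z. z \<notin> T \<Longrightarrow> cycle_winding_number \<Gamma> z = (\<Sum>e\<leftarrow>L. winding_number (edge_path \<delta> e) z)"
    by (auto simp: o_def)
  have sq: "z \<in> grid_square \<delta> (\<lfloor>Re z / \<delta>\<rfloor>, \<lfloor>Im z / \<delta>\<rfloor>)" for z
    by (rule floor_grid_square[OF \<open>\<delta> > 0\<close>])
  have "surrounds_in \<Gamma> K U"
    unfolding surrounds_in_def
  proof (intro conjI allI ballI impI)
    show "cycle_in \<Gamma> U" using \<Gamma>(1) TU by (auto simp: cycle_in_def)
    show "path_image \<gamma> \<inter> K = {}" if "\<gamma> \<in> set \<Gamma>" for \<gamma>
      using \<Gamma>(1) TK that by (auto simp: cycle_in_def)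
    show "cycle_winding_number \<Gamma> z = 0" if "z \<notin> U" for z
    proof -
      have "z \<notin> T" using TU that by blast
      moreover have "(\<lfloor>Re z / \<delta>\<rfloor>, \<lfloor>Im z / \<delta>\<rfloor>) \<notin> S" using SU sq that by blast
      ultimately show ?thesis using wind[OF sq] \<Gamma>(2) by simp
    qed
    show "cycle_winding_number \<Gamma> z = 1" if "z \<in> K" for z
    proof -
      have "z \<notin> T" using TK that by blast
      moreover have "(\<lfloor>Re z / \<delta>\<rfloor>, \<lfloor>Im z / \<delta>\<rfloor>) \<in> S" using sq that by (auto simp: S_def)
      ultimately show ?thesis using wind[OF sq] \<Gamma>(2) by simp
    qed
  qed fact
  then show thesis by (rule that)
qed

section \<open>Inversion and the spectrum\<close>

lemma is_inverse_of_unique: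
  assumes "is_inverse_of y x" "is_inverse_of y' x"
  shows "y = y'"
  using assms unfolding is_inverse_of_def by (metis mult.assoc mult_1_left mult_1_right)

text \<open>
  The units of the monoid and the inversion on them. The resolvent is inversion composed with an affine
  map of the algebra element and the spectral parameter, so the facts about inversion cover both
  variables at once.
\<close>
definition units :: "'a::monoid_mult set" where
  "units = {x. \<exists>y. is_inverse_of y x}"

definition inv_of :: "'a::monoid_mult \<Rightarrow> 'a" where
  "inv_of x = (THE y. is_inverse_of y x)"

lemma inv_of_eqI: "is_inverse_of y x \<Longrightarrow> inv_of x = y"
  unfolding inv_of_def by (blast intro: the_equality is_inverse_of_unique)

lemma inv_of_units:
  assumes "x \<in> units"
  shows "x * inv_of x = 1" "inv_of x * x = 1"
proof -
  obtain y where "is_inverse_of y x" using assms by (auto simp: units_def)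
  then show "x * inv_of x = 1" "inv_of x * x = 1"
    using inv_of_eqI[of y x] by (simp_all add: is_inverse_of_def)
qed

lemma unitsI: "x * y = 1 \<Longrightarrow> y * x = 1 \<Longrightarrow> x \<in> units"
  by (auto simp: units_def is_inverse_of_def)

lemma units_mult:
  assumes "x \<in> units" "y \<in> units"
  shows "x * y \<in> units"
proof (rule unitsI)
  show "x * y * (inv_of y * inv_of x) = 1"
    by (metis assms inv_of_units(1) mult.assoc mult_1_left)
  show "inv_of y * inv_of x * (x * y) = 1"
    by (metis assms inv_of_units(2) mult.assoc mult_1_left)
qed

text \<open>
  The Neumann series. The norm of the unit element may differ from one, so the geometric bound holds for the
  powers with positive exponent, and the comparison starts with the second term of the series.
\<close>
lemma one_minus_in_units:
  fixes x :: "'a::{real_algebra_1, real_normed_algebra, banach}"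
  assumes "norm x < 1"
  shows "1 - x \<in> units"
proof -
  have le: "norm (x ^ Suc n) \<le> norm x ^ Suc n" for n
  proof (induction n)
    case (Suc n)
    have "norm (x ^ Suc (Suc n)) \<le> norm x * norm (x ^ Suc n)"
      by (simp add: norm_mult_ineq)
    also have "\<dots> \<le> norm x * norm x ^ Suc n"
      by (rule mult_left_mono[OF Suc]) simp
    finally show ?case by simp
  qed simp
  have "summable (\<lambda>n. norm x ^ n)" using assms by (simp add: summable_geometric)
  then have "summable (\<lambda>n. norm x ^ Suc n)" by (simp only: summable_Suc_iff)
  then have "summable (\<lambda>n. x ^ Suc n)"
    using le by (rule summable_comparison_test'[where N = 0])
  then have sum: "summable (\<lambda>n. x ^ n)" by (simp only: summable_Suc_iff)
  define y where "y = (\<Sum>n. x ^ n)"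
  have tail: "(\<Sum>n. x ^ Suc n) = y - 1"
    using suminf_split_head[OF sum] by (simp add: y_def)
  have "x * y = y - 1"
    using suminf_mult[OF sum, of x] tail by (simp add: y_def)
  moreover have "y * x = y - 1"
    using suminf_mult2[OF sum, of x] tail by (simp add: y_def power_commutes)
  ultimately show ?thesis
    by (intro unitsI[of _ y]) (simp_all add: algebra_simps)
qed

lemma perturbed_in_units:
  fixes x :: "'a::{real_algebra_1, real_normed_algebra, banach}"
  assumes x: "x \<in> units" and h: "norm (y - x) * norm (inv_of x) < 1"
  shows "y \<in> units"
proof -
  have "norm ((x - y) * inv_of x) < 1"
    using norm_mult_ineq[of "x - y" "inv_of x"] h by (simp add: norm_minus_commute)
  then have "1 - (x - y) * inv_of x \<in> units" by (rule one_minus_in_units)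
  then have "(1 - (x - y) * inv_of x) * x \<in> units" using x by (rule units_mult)
  moreover have "(1 - (x - y) * inv_of x) * x = y"
    using inv_of_units(2)[OF x] by (simp add: left_diff_distrib mult.assoc)
  ultimately show ?thesis by simp
qed

lemma open_units: "open (units :: 'a::{real_algebra_1, real_normed_algebra, banach} set)"
  unfolding open_contains_ball
proof (intro ballI)
  fix x :: 'a assume x: "x \<in> units"
  have "y \<in> units" if "y \<in> ball x (1 / (norm (inv_of x) + 1))" for y
  proof (rule perturbed_in_units[OF x])
    have "norm (y - x) * (norm (inv_of x) + 1) < 1"
      using that by (simp add: dist_norm norm_minus_commute field_simps add_pos_nonneg)
    moreover have "norm (y - x) * norm (inv_of x) \<le> norm (y - x) * (norm (inv_of x) + 1)"
      by (intro mult_left_mono) auto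
    ultimately show "norm (y - x) * norm (inv_of x) < 1" by linarith
  qed
  then show "\<exists>e>0. ball x e \<subseteq> units"
    by (intro exI[of _ "1 / (norm (inv_of x) + 1)"]) (auto simp: add_nonneg_pos)
qed

lemma inv_of_diff:
  fixes x y :: "'a::ring_1"
  assumes "x \<in> units" "y \<in> units"
  shows "inv_of y - inv_of x = inv_of y * (x - y) * inv_of x"
proof -
  have "inv_of y * (x - y) * inv_of x = inv_of y * (x * inv_of x) - (inv_of y * y) * inv_of x"
    by (simp add: algebra_simps)
  then show ?thesis by (simp add: inv_of_units(1)[OF assms(1)] inv_of_units(2)[OF assms(2)])
qed

text \<open>
  Close to \<open>x\<close>, the identity \<open>inv_of_diff\<close> first bounds the norm of \<open>inv_of y\<close> by twice that of
  \<open>inv_of x\<close>, and then shows that the difference is of the order of \<open>y - x\<close>.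
\<close>
lemma isCont_inv_of:
  fixes x :: "'a::{real_algebra_1, real_normed_algebra, banach}"
  assumes x: "x \<in> units"
  shows "isCont inv_of x"
proof -
  define m where "m = norm (inv_of x)"
  have "m \<ge> 0" by (simp add: m_def)
  have bound: "norm (inv_of y - inv_of x) \<le> 2 * m ^ 2 * norm (y - x)" if "norm (y - x) * m < 1/2" for y
  proof -
    have y: "y \<in> units" using that by (intro perturbed_in_units[OF x]) (simp add: m_def)
    define n where "n = norm (inv_of y)"
    have "norm (inv_of y * (x - y) * inv_of x) \<le> n * norm (y - x) * m"
      unfolding n_def m_def norm_minus_commute[of y]
      by (intro norm_mult_ineq[THEN order_trans] mult_right_mono norm_mult_ineq norm_ge_zero)
    then have le: "norm (inv_of y - inv_of x) \<le> n * norm (y - x) * m"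
      by (simp add: inv_of_diff[OF x y])
    have "n \<le> m + norm (inv_of y - inv_of x)"
      unfolding n_def m_def by (metis add.commute diff_add_cancel norm_triangle_ineq)
    also have "\<dots> \<le> m + n * (norm (y - x) * m)" using le by (simp add: mult.assoc)
    also have "\<dots> \<le> m + n * (1/2)"
      using that by (intro add_left_mono mult_left_mono) (auto simp: n_def)
    finally have "n \<le> 2 * m" by simp
    then have "n * (norm (y - x) * m) \<le> (2 * m) * (norm (y - x) * m)"
      using \<open>m \<ge> 0\<close> by (intro mult_right_mono) auto
    then show ?thesis using le by (simp add: power2_eq_square algebra_simps)
  qed
  have "((\<lambda>y. norm (y - x) * m) \<longlongrightarrow> norm (x - x) * m) (at x)"
    by (intro tendsto_intros)
  then have "\<forall>\<^sub>F y in at x. norm (y - x) * m < 1/2"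
    by (intro order_tendstoD(2)[of _ "norm (x - x) * m"]) auto
  then have "\<forall>\<^sub>F y in at x. norm (inv_of y - inv_of x) \<le> 2 * m ^ 2 * norm (y - x)"
    by eventually_elim (rule bound)
  moreover have "((\<lambda>y. 2 * m ^ 2 * norm (y - x)) \<longlongrightarrow> 2 * m ^ 2 * norm (x - x)) (at x)"
    by (intro tendsto_intros)
  then have "((\<lambda>y. 2 * m ^ 2 * norm (y - x)) \<longlongrightarrow> 0) (at x)" by simp
  ultimately have "((\<lambda>y. inv_of y - inv_of x) \<longlongrightarrow> 0) (at x)"
    by (rule Lim_null_comparison)
  then show ?thesis unfolding isCont_def by (rule LIM_zero_cancel)
qed

lemma continuous_on_inv_of:
  "continuous_on (units :: 'a::{real_algebra_1, real_normed_algebra, banach} set) inv_of"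
  by (simp add: continuous_at_imp_continuous_on isCont_inv_of)

text \<open>
  The error of the linear approximation is \<open>(inv_of y - inv_of x) * (x - y) * inv_of x\<close>, in which the first factor tends to zero.
\<close>
lemma has_derivative_inv_of:
  fixes x :: "'a::{real_algebra_1, real_normed_algebra, banach}"
  assumes x: "x \<in> units"
  shows "(inv_of has_derivative (\<lambda>h. - (inv_of x * h * inv_of x))) (at x)"
  unfolding has_derivative_iff_norm
proof
  show "bounded_linear (\<lambda>h. - (inv_of x * h * inv_of x))"
    by (intro bounded_linear_minus bounded_linear_mult_const bounded_linear_mult_right)
  have "\<forall>\<^sub>F y in at x. y \<in> units"
    using open_units x by (metis eventually_at_topological)
  then have "\<forall>\<^sub>F y in at x. norm (norm (inv_of y - inv_of x - - (inv_of x * (y - x) * inv_of x)) / norm (y - x))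
      \<le> norm (inv_of y - inv_of x) * norm (inv_of x)"
  proof eventually_elim
    case (elim y)
    have "inv_of y - inv_of x - - (inv_of x * (y - x) * inv_of x)
        = (inv_of y - inv_of x) * (x - y) * inv_of x"
      by (subst inv_of_diff[OF x elim]) (simp add: algebra_simps)
    also have "norm \<dots> \<le> norm (inv_of y - inv_of x) * norm (x - y) * norm (inv_of x)"
      by (intro norm_mult_ineq[THEN order_trans] mult_right_mono norm_mult_ineq norm_ge_zero)
    finally show ?case
      by (cases "y = x") (simp_all add: divide_le_eq norm_minus_commute[of x] mult_ac)
  qed
  moreover have "((\<lambda>y. norm (inv_of y - inv_of x) * norm (inv_of x)) \<longlongrightarrow> norm (inv_of x - inv_of x) * norm (inv_of x)) (at x)"
    using isCont_inv_of[OF x] unfolding isCont_def by (intro tendsto_intros)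
  then have "((\<lambda>y. norm (inv_of y - inv_of x) * norm (inv_of x)) \<longlongrightarrow> 0) (at x)" by simp
  ultimately show "((\<lambda>y. norm (inv_of y - inv_of x - - (inv_of x * (y - x) * inv_of x)) / norm (y - x)) \<longlongrightarrow> 0) (at x)"
    by (rule Lim_null_comparison)
qed

lemma resolvent_eq: "resolvent a z = inv_of (z *\<^sub>C 1 - a)"
  by (simp add: resolvent_def inv_of_def)

lemma notin_spectrum: "z \<notin> spectrum a \<longleftrightarrow> z *\<^sub>C 1 - a \<in> units"
  by (simp add: spectrum_def units_def)

lemma open_resolvent_pairs:
  "open {(a :: 'a::complex_banach_algebra_1, z). z \<notin> spectrum a}"
proof -
  have "continuous_on UNIV (\<lambda>p :: 'a \<times> complex. snd p *\<^sub>C 1 - fst p)"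
    by (intro continuous_intros)
  then have "open ((\<lambda>p :: 'a \<times> complex. snd p *\<^sub>C 1 - fst p) -` units)"
    by (rule open_vimage[OF open_units])
  moreover have "(\<lambda>p :: 'a \<times> complex. snd p *\<^sub>C 1 - fst p) -` units = {(a, z). z \<notin> spectrum a}"
    by (auto simp: notin_spectrum)
  ultimately show ?thesis by simp
qed

lemma spectrum_norm_le:
  fixes a :: "'a::complex_banach_algebra_1"
  assumes "z \<in> spectrum a"
  shows "norm z \<le> norm a"
proof (rule ccontr)
  assume "\<not> norm z \<le> norm a"
  then have z: "norm a < norm z" "z \<noteq> 0" by auto
  have "norm ((1 / z) *\<^sub>C a) < 1" using z by (simp add: norm_scaleC norm_divide)
  then have u: "1 - (1 / z) *\<^sub>C a \<in> units" by (rule one_minus_in_units)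
  moreover have "z *\<^sub>C (1::'a) \<in> units"
    using z by (intro unitsI[of _ "(1 / z) *\<^sub>C 1"]) (simp_all add: mult_scaleC_left scaleC_scaleC)
  ultimately have "z *\<^sub>C 1 * (1 - (1 / z) *\<^sub>C a) \<in> units" by (rule units_mult[rotated])
  moreover have "z *\<^sub>C 1 * (1 - (1 / z) *\<^sub>C a) = z *\<^sub>C 1 - a"
    using z by (simp add: mult_scaleC_left scaleC.diff_right scaleC_scaleC)
  ultimately show False using assms notin_spectrum by auto
qed

text \<open>
  The pairs \<open>(x, z)\<close> with \<open>z\<close> outside the spectrum of \<open>x\<close> form an open set, so the tube lemma applies to \<open>{a} \<times> C\<close>.
\<close>
lemma eventually_compact_disjoint_spectrum:
  fixes a :: "'a::complex_banach_algebra_1"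
  assumes "compact C" "C \<inter> spectrum a = {}"
  shows "\<forall>\<^sub>F x in nhds a. C \<inter> spectrum x = {}"
proof -
  have "{a} \<times> C \<subseteq> {(a, z). z \<notin> spectrum a}" using assms(2) by auto
  then obtain X where "a \<in> X" "open X" and X: "X \<times> C \<subseteq> {(a, z). z \<notin> spectrum a}"
    using Elementary_Topology.tube_lemma[OF assms(1) open_resolvent_pairs] by metis
  then show ?thesis
    unfolding eventually_nhds by (intro exI[of _ X]) auto
qed

lemma closed_spectrum: "closed (spectrum (a :: 'a::complex_banach_algebra_1))"
proof -
  have "open (Pair a -` {(a, z). z \<notin> spectrum a})"
    by (rule open_vimage[OF open_resolvent_pairs]) (intro continuous_intros)
  then show ?thesis by (simp add: closed_def vimage_def Compl_eq)
qed

lemma compact_spectrum: "compact (spectrum (a :: 'a::complex_banach_algebra_1))"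
  unfolding compact_eq_bounded_closed bounded_iff
  using closed_spectrum spectrum_norm_le by blast

text \<open>
  Upper semicontinuity of the spectrum. Near \<open>a\<close> all spectra lie in one fixed disc, and the part of the disc
  outside the open set is compact.
\<close>
lemma eventually_spectrum_subset:
  fixes a :: "'a::complex_banach_algebra_1"
  assumes "open N'" "spectrum a \<subseteq> N'"
  shows "\<forall>\<^sub>F x in nhds a. spectrum x \<subseteq> N'"
proof -
  \<comment> \<open>The radius leaves room for the norms of all elements at distance less than one from \<open>a\<close>.\<close>
  define C where "C = cball 0 (norm a + 1) - N'"
  have "compact C" using assms(1) by (simp add: C_def compact_diff)
  then have "\<forall>\<^sub>F x in nhds a. C \<inter> spectrum x = {}"
    using assms(2) by (intro eventually_compact_disjoint_spectrum) (auto simp: C_def)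
  moreover have "\<forall>\<^sub>F x in nhds a. dist x a < 1"
    unfolding eventually_nhds_metric by (rule exI[of _ 1]) simp
  ultimately show ?thesis
  proof eventually_elim
    case (elim x)
    then have "norm x \<le> norm a + 1"
      using norm_triangle_sub[of x a] by (simp add: dist_norm)
    then show ?case using elim(1) spectrum_norm_le[of _ x] by (force simp: C_def)
  qed
qed

lemma open_spectrum_in:
  assumes "open U"
  shows "open (spectrum_in U :: 'a::complex_banach_algebra_1 set)"
proof (subst open_subopen, intro ballI)
  fix a :: 'a assume "a \<in> spectrum_in U"
  then have "\<forall>\<^sub>F x in nhds a. x \<in> spectrum_in U"
    using eventually_spectrum_subset[OF assms] by (simp add: spectrum_in_def)
  then show "\<exists>T. open T \<and> a \<in> T \<and> T \<subseteq> spectrum_in U"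
    unfolding eventually_nhds by blast
qed

section \<open>Words in the resolvent\<close>

fun inserts :: "'b \<Rightarrow> 'b list \<Rightarrow> 'b list list" where
  "inserts x [] = [[x]]"
| "inserts x (y # ys) = (x # y # ys) # map ((#) y) (inserts x ys)"

lemma map_inserts: "map (map f) (inserts x ys) = inserts (f x) (map f ys)"
proof (induction ys)
  case (Cons y ys)
  show ?case by (simp add: Cons[symmetric] o_def)
qed simp

text \<open>
  The word \<open>R c\<^sub>1 R c\<^sub>2 \<dots> c\<^sub>k R\<close>. With the resolvent as \<open>R\<close> and the directions as letters it is
  the integrand of the formula for the iterated derivative.
\<close>
fun interleave :: "'a::monoid_mult \<Rightarrow> 'a list \<Rightarrow> 'a" where
  "interleave R [] = R"
| "interleave R (c # cs) = R * c * interleave R cs"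

lemma prod_list_eq_interleave:
  "prod_list (map (\<lambda>j. R * b j) xs) * R = interleave R (map b xs)"
  by (induction xs) (simp_all add: mult.assoc)

text \<open>
  Inserting \<open>x\<close> in all positions of a word amounts to replacing each factor \<open>R\<close> in turn by \<open>R x R\<close>,
  which is how the product rule acts on the word.
\<close>
definition interleave_insert :: "'a::ring_1 \<Rightarrow> 'a \<Rightarrow> 'a list \<Rightarrow> 'a" where
  "interleave_insert R x cs = (\<Sum>ys\<leftarrow>inserts x cs. interleave R ys)"

lemma interleave_insert_simps [simp]:
  "interleave_insert R x [] = R * x * R"
  "interleave_insert R x (c # cs) = R * x * R * c * interleave R cs + R * c * interleave_insert R x cs"
  by (simp_all add: interleave_insert_def o_def sum_list_const_mult mult.assoc)

lemma interleave_insert_scaleC: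
  "interleave_insert R (c *\<^sub>C x) cs = c *\<^sub>C interleave_insert (R::'a::complex_banach_algebra_1) x cs"
  by (induction cs) (simp_all add: mult_scaleC_left mult_scaleC_right scaleC_add_right)

lemma interleave_insert_minus:
  "interleave_insert R (- x) cs = - interleave_insert R x cs"
  by (induction cs) simp_all

text \<open>
  The derivative of the inverse in direction \<open>h\<close> is \<open>- (R h R)\<close>; by the product rule each of the factors \<open>R\<close> contributes
  one summand with \<open>- h\<close> inserted at its place.
\<close>
lemma has_derivative_interleave:
  fixes x :: "'a::{real_algebra_1, real_normed_algebra, banach}"
  assumes x: "x \<in> units"
  shows "((\<lambda>x. interleave (inv_of x) cs) has_derivative (\<lambda>h. interleave_insert (inv_of x) (- h) cs)) (at x)"
proof (induction cs)
  case Nil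
  show ?case using has_derivative_inv_of[OF x] by simp
next
  case (Cons c cs)
  show ?case
    unfolding interleave.simps interleave_insert_simps
    by (rule has_derivative_eq_rhs[OF has_derivative_mult[OF has_derivative_mult_left[OF has_derivative_inv_of[OF x]] Cons]])
       (simp add: fun_eq_iff algebra_simps)
qed

lemma continuous_on_interleave [continuous_intros]:
  fixes R :: "'b::topological_space \<Rightarrow> 'a::{real_algebra_1, real_normed_algebra}"
  assumes "continuous_on S R"
  shows "continuous_on S (\<lambda>p. interleave (R p) cs)"
  by (induction cs) (use assms in \<open>auto intro!: continuous_intros\<close>)

lemma continuous_on_interleave_insert [continuous_intros]:
  fixes R :: "'b::topological_space \<Rightarrow> 'a::{real_algebra_1, real_normed_algebra}"
  assumes "continuous_on S R"
  shows "continuous_on S (\<lambda>p. interleave_insert (R p) x cs)"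
  by (induction cs) (use assms in \<open>auto intro!: continuous_intros\<close>)

lemma continuous_on_resolvent [continuous_intros]:
  fixes a :: "'b::topological_space \<Rightarrow> 'a::complex_banach_algebra_1"
  assumes "continuous_on S a" "continuous_on S \<zeta>" "\<And>p. p \<in> S \<Longrightarrow> \<zeta> p \<notin> spectrum (a p)"
  shows "continuous_on S (\<lambda>p. resolvent (a p) (\<zeta> p))"
  unfolding resolvent_eq
  by (rule continuous_on_compose2[OF continuous_on_inv_of])
     (use assms in \<open>auto intro!: continuous_intros simp: notin_spectrum\<close>)

text \<open>
  Moving \<open>z\<close> by \<open>h\<close> moves \<open>z - a\<close> by the multiple \<open>h\<close> of the unit element, so the inserted letter is \<open>- 1\<close>.
\<close>
lemma has_derivative_resolvent_word:
  fixes a :: "'a::complex_banach_algebra_1"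
  assumes "z \<notin> spectrum a"
  shows "((\<lambda>z. interleave (resolvent a z) cs) has_derivative
           (\<lambda>h. h *\<^sub>C interleave_insert (resolvent a z) (- 1) cs)) (at z)"
proof -
  have "((\<lambda>z. z *\<^sub>C 1 - a) has_derivative (\<lambda>h. h *\<^sub>C 1)) (at z)"
    using bounded_linear.has_derivative[OF scaleC.bounded_linear_left has_derivative_ident]
    by (auto intro!: derivative_eq_intros)
  from has_derivative_compose[OF this has_derivative_interleave]
  have "((\<lambda>z. interleave (inv_of (z *\<^sub>C 1 - a)) cs) has_derivative
          (\<lambda>h. interleave_insert (inv_of (z *\<^sub>C 1 - a)) (- (h *\<^sub>C 1)) cs)) (at z)"
    using assms by (simp add: notin_spectrum)
  then show ?thesis
    by (simp add: resolvent_eq interleave_insert_minus interleave_insert_scaleC scaleC.minus_right)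
qed

lemma has_derivative_resolvent_word_direction:
  fixes a b :: "'a::complex_banach_algebra_1"
  assumes "z \<notin> spectrum (a + s *\<^sub>C b)"
  shows "((\<lambda>s. interleave (resolvent (a + s *\<^sub>C b) z) cs) has_derivative
           (\<lambda>h. h *\<^sub>C interleave_insert (resolvent (a + s *\<^sub>C b) z) b cs)) (at s)"
proof -
  have "((\<lambda>s. z *\<^sub>C 1 - (a + s *\<^sub>C b)) has_derivative (\<lambda>h. - (h *\<^sub>C b))) (at s)"
    using bounded_linear.has_derivative[OF scaleC.bounded_linear_left has_derivative_ident]
    by (auto intro!: derivative_eq_intros)
  from has_derivative_compose[OF this has_derivative_interleave]
  have "((\<lambda>s. interleave (inv_of (z *\<^sub>C 1 - (a + s *\<^sub>C b))) cs) has_derivative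
          (\<lambda>h. interleave_insert (inv_of (z *\<^sub>C 1 - (a + s *\<^sub>C b))) (- (- (h *\<^sub>C b))) cs)) (at s)"
    using assms by (simp only: notin_spectrum)
  then show ?thesis
    by (simp only: resolvent_eq minus_minus interleave_insert_scaleC)
qed

lemma C1_holomorphic_on_resolvent_word:
  fixes a :: "'a::complex_banach_algebra_1"
  assumes "open U" "f holomorphic_on U" "V \<subseteq> U" "V \<inter> spectrum a = {}"
  shows "C1_holomorphic_on (\<lambda>z. f z *\<^sub>C interleave (resolvent a z) cs) V"
  unfolding C1_holomorphic_on_def
proof (intro exI conjI ballI)
  have "continuous_on U f" "continuous_on U (deriv f)"
    using assms holomorphic_on_imp_continuous_on holomorphic_deriv by blast+
  then have "continuous_on V f" "continuous_on V (deriv f)"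
    using assms(3) continuous_on_subset by blast+
  then show "continuous_on V (\<lambda>z. deriv f z *\<^sub>C interleave (resolvent a z) cs
      + f z *\<^sub>C interleave_insert (resolvent a z) (- 1) cs)"
    using assms(4) by (auto intro!: continuous_intros)
  fix z assume z: "z \<in> V"
  have "(f has_field_derivative deriv f z) (at z)"
    using holomorphic_derivI[OF assms(2,1)] assms(3) z by blast
  then have "(f has_derivative (\<lambda>h. deriv f z * h)) (at z)"
    by (simp add: has_field_derivative_def)
  moreover have "z \<notin> spectrum a" using assms(4) z by auto
  ultimately show "((\<lambda>z. f z *\<^sub>C interleave (resolvent a z) cs) has_derivative
     (\<lambda>h. h *\<^sub>C (deriv f z *\<^sub>C interleave (resolvent a z) cs
        + f z *\<^sub>C interleave_insert (resolvent a z) (- 1) cs))) (at z)"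
    by (intro has_derivative_eq_rhs[OF scaleC.FDERIV[OF _ has_derivative_resolvent_word]])
       (auto simp: fun_eq_iff scaleC_add_right scaleC_scaleC mult.commute)
qed

text \<open>
  Every arrangement of \<open>1, \<dots>, k + 1\<close> arises exactly once from inserting \<open>k + 1\<close> into an arrangement of
  \<open>1, \<dots>, k\<close>. This matches the effect of one more differentiation on words.
\<close>
lemma sum_permutations_Suc:
  fixes h :: "nat list \<Rightarrow> 'c::comm_monoid_add"
  shows "(\<Sum>ys\<in>permutations_of_set {1..Suc k}. h ys) =
     (\<Sum>xs\<in>permutations_of_set {1..k}. \<Sum>ys\<leftarrow>inserts (Suc k) xs. h ys)"
proof -
  have ins: "(\<Sum>ys\<leftarrow>inserts x xs. g ys) = (\<Sum>i\<in>{..length xs}. g (take i xs @ x # drop i xs))"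
    for x :: nat and xs and g :: "nat list \<Rightarrow> 'c"
  proof (induction xs arbitrary: g)
    case (Cons y xs)
    have "(\<Sum>ys\<leftarrow>inserts x (y # xs). g ys) = g (x # y # xs) + (\<Sum>ys\<leftarrow>inserts x xs. g (y # ys))"
      by (simp add: o_def)
    also have "\<dots> = g (x # y # xs) + (\<Sum>i\<in>{..length xs}. g (y # take i xs @ x # drop i xs))"
      by (simp only: Cons.IH)
    also have "\<dots> = (\<Sum>i\<in>{..Suc (length xs)}. g (take i (y # xs) @ x # drop i (y # xs)))"
      by (subst sum.atMost_Suc_shift) simp
    finally show ?case by simp
  qed simp
  have len: "length xs = k" if "xs \<in> permutations_of_set {1..k}" for xs
    using permutations_of_setD[OF that] distinct_card[of xs] by simp
  let ?P = "permutations_of_set {1..k} \<times> {..k}"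
  let ?ins = "\<lambda>(xs, i). take i xs @ Suc k # drop i xs"
  have range: "{1..Suc k} = insert (Suc k) {1..k}" by auto
  have "inj_on ?ins ?P"
  proof (rule inj_onI, clarify)
    fix xs i ys j
    assume xs: "xs \<in> permutations_of_set {1..k}" "i \<le> k" and ys: "ys \<in> permutations_of_set {1..k}" "j \<le> k"
      and eq: "take i xs @ Suc k # drop i xs = take j ys @ Suc k # drop j ys"
    have "Suc k \<notin> set xs" "Suc k \<notin> set ys"
      using permutations_of_setD(1)[OF xs(1)] permutations_of_setD(1)[OF ys(1)] by simp_all
    then have "Suc k \<notin> set (take i xs)" "Suc k \<notin> set (take j ys)" "Suc k \<notin> set (drop i xs)"
      by (meson in_set_takeD in_set_dropD)+
    then have e: "take i xs = take j ys" "drop i xs = drop j ys"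
      using eq by (simp_all add: append_Cons_eq_iff)
    then have "xs = ys" by (metis append_take_drop_id)
    moreover have "i = j"
      using arg_cong[OF e(1), of length] len[OF xs(1)] len[OF ys(1)] xs(2) ys(2) by simp
    ultimately show "xs = ys \<and> i = j" by simp
  qed
  moreover have "?ins ` ?P = permutations_of_set {1..Suc k}"
  proof (intro equalityI subsetI)
    fix zs assume "zs \<in> ?ins ` ?P"
    then obtain xs i where zs: "zs = take i xs @ Suc k # drop i xs" and xs: "xs \<in> permutations_of_set {1..k}"
      by auto
    have "mset zs = add_mset (Suc k) (mset (take i xs @ drop i xs))"
      unfolding zs by (simp only: mset_append mset.simps union_mset_add_mset_right)
    then have m: "mset zs = mset (Suc k # xs)"
      by (simp only: append_take_drop_id mset.simps)
    show "zs \<in> permutations_of_set {1..Suc k}"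
    proof (rule permutations_of_setI)
      show "set zs = {1..Suc k}"
        using mset_eq_setD[OF m] permutations_of_setD(1)[OF xs] range by simp
      show "distinct zs"
        using mset_eq_imp_distinct_iff[OF m] permutations_of_setD[OF xs] by simp
    qed
  next
    fix zs assume zs: "zs \<in> permutations_of_set {1..Suc k}"
    then have "Suc k \<in> set zs" using permutations_of_setD(1)[OF zs] by simp
    then obtain us vs where uv: "zs = us @ Suc k # vs" by (meson split_list)
    have d: "set zs = {1..Suc k}" "distinct zs" using permutations_of_setD[OF zs] by auto
    then have "set (us @ vs) = set zs - {Suc k}" by (auto simp: uv)
    also have "\<dots> = {1..k}" unfolding d(1) by auto
    finally have p: "us @ vs \<in> permutations_of_set {1..k}"
      using d(2) by (intro permutations_of_setI) (simp_all add: uv)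
    then have "length us \<le> k" using len[OF p] by simp
    then show "zs \<in> ?ins ` ?P"
      using p by (intro image_eqI[of _ _ "(us @ vs, length us)"]) (simp_all add: uv del: atLeastAtMost_iff)
  qed
  ultimately have "(\<Sum>ys\<in>permutations_of_set {1..Suc k}. h ys) = (\<Sum>p\<in>?P. h (?ins p))"
    by (intro sum.reindex_cong[of ?ins]) auto
  also have "\<dots> = (\<Sum>xs\<in>permutations_of_set {1..k}. \<Sum>i\<in>{..k}. h (take i xs @ Suc k # drop i xs))"
    by (simp add: sum.cartesian_product case_prod_unfold)
  also have "\<dots> = (\<Sum>xs\<in>permutations_of_set {1..k}. \<Sum>ys\<leftarrow>inserts (Suc k) xs. h ys)"
    by (intro sum.cong refl) (simp only: ins len)
  finally show ?thesis .
qed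

lemma sum_permutes_eq_sum_permutations_of_set:
  "(\<Sum>\<pi> | \<pi> permutes {1..k}. h (map \<pi> [1..<Suc k])) = (\<Sum>xs\<in>permutations_of_set {1..k}. h xs)"
proof -
  \<comment> \<open>Listing the values of a permutation identifies permutations with arrangements.\<close>
  let ?F = "\<lambda>\<pi>. map \<pi> [1..<Suc k]"
  have set: "set [1..<Suc k] = {1..k}" by auto
  have inj: "inj_on ?F {\<pi>. \<pi> permutes {1..k}}"
  proof (rule inj_onI)
    fix \<pi> \<rho> assume p: "\<pi> \<in> {\<pi>. \<pi> permutes {1..k}}" "\<rho> \<in> {\<pi>. \<pi> permutes {1..k}}" and "?F \<pi> = ?F \<rho>"
    then have eq: "\<pi> j = \<rho> j" if "j \<in> {1..k}" for j
      using that unfolding map_eq_conv set by blast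
    show "\<pi> = \<rho>"
    proof
      fix j show "\<pi> j = \<rho> j"
        using p eq[of j] by (cases "j \<in> {1..k}") (simp_all add: permutes_not_in del: atLeastAtMost_iff)
    qed
  qed
  have "?F ` {\<pi>. \<pi> permutes {1..k}} \<subseteq> permutations_of_set {1..k}"
  proof clarify
    fix \<pi> assume "\<pi> permutes {1..k}"
    then show "?F \<pi> \<in> permutations_of_set {1..k}"
      by (intro permutations_of_setI)
         (simp_all only: set_map set distinct_map distinct_upt permutes_image permutes_inj_on)
  qed
  moreover have "card (?F ` {\<pi>. \<pi> permutes {1..k}}) = card (permutations_of_set {1..k})"
    unfolding card_image[OF inj] by (subst card_permutations[of "{1..k}" k]) simp_all
  ultimately have "?F ` {\<pi>. \<pi> permutes {1..k}} = permutations_of_set {1..k}"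
    by (intro card_subset_eq) simp_all
  then show ?thesis
    using sum.reindex[OF inj, of h] by simp
qed

section \<open>Differentiating the functional calculus\<close>

lemma has_derivative_sum_list:
  assumes "\<And>e. e \<in> set L \<Longrightarrow> (F e has_derivative D e) net"
  shows "((\<lambda>x. \<Sum>e\<leftarrow>L. F e x) has_derivative (\<lambda>h. \<Sum>e\<leftarrow>L. D e h)) net"
  using assms by (induction L) (auto intro!: has_derivative_add)

lemma scaleC_sum_list: "c *\<^sub>C (\<Sum>x\<leftarrow>xs. f x) = (\<Sum>x\<leftarrow>xs. c *\<^sub>C f x)"
  by (induction xs) (simp_all add: scaleC_add_right scaleC.zero_right)

lemma sum_list_swap:
  fixes f :: "'b \<Rightarrow> 'c \<Rightarrow> 'a::comm_monoid_add"
  shows "(\<Sum>x\<leftarrow>xs. \<Sum>y\<leftarrow>ys. f x y) = (\<Sum>y\<leftarrow>ys. \<Sum>x\<leftarrow>xs. f x y)"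
  by (induction xs) (simp_all add: sum_list_addf)

lemma continuous_on_linepath_integrand:
  assumes "continuous_on (closed_segment p q) g"
  shows "continuous_on {0..1} (\<lambda>t. (q - p) *\<^sub>C g (linepath p q t))"
proof -
  have "continuous_on {0..1} (\<lambda>t. g (linepath p q t))"
    by (rule continuous_on_compose2[OF assms continuous_on_linepath])
       (auto simp: linepath_image_01)
  then show ?thesis by (intro continuous_intros)
qed

lemma path_integral_linepath_scaleC:
  fixes g :: "complex \<Rightarrow> 'a::complex_banach"
  assumes "continuous_on (closed_segment p q) g"
  shows "path_integral (linepath p q) (\<lambda>z. c *\<^sub>C g z) = c *\<^sub>C path_integral (linepath p q) g"
  unfolding path_integral_linepath_eq
  using integral_linear[OF integrable_continuous_real[OF continuous_on_linepath_integrand[OF assms]]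
      scaleC.bounded_linear_right[of c]]
  by (simp add: o_def scaleC_left_commute)

lemma path_integral_linepath_sum_list:
  fixes g :: "'b \<Rightarrow> complex \<Rightarrow> 'a::complex_banach"
  assumes "\<And>y. y \<in> set ys \<Longrightarrow> continuous_on (closed_segment p q) (g y)"
  shows "path_integral (linepath p q) (\<lambda>z. \<Sum>y\<leftarrow>ys. g y z) = (\<Sum>y\<leftarrow>ys. path_integral (linepath p q) (g y))"
  using assms
proof (induction ys)
  case (Cons y ys)
  have c: "continuous_on (closed_segment p q) (\<lambda>z. \<Sum>y\<leftarrow>ys. g y z)"
    using Cons.prems by (induction ys) (auto intro!: continuous_intros)
  have "path_integral (linepath p q) (\<lambda>z. g y z + (\<Sum>y\<leftarrow>ys. g y z)) =
      path_integral (linepath p q) (g y) + path_integral (linepath p q) (\<lambda>z. \<Sum>y\<leftarrow>ys. g y z)"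
    unfolding path_integral_linepath_eq scaleC_add_right
    using Cons.prems c
    by (intro integral_add integrable_continuous_real continuous_on_linepath_integrand) auto
  then show ?case using Cons by simp
qed (simp add: path_integral_linepath_eq scaleC.zero_right)

text \<open>
  The integral over an arbitrary cycle becomes a finite sum of integrals over segments, simultaneously for all integrands
  that are holomorphic on one compact set \<open>C\<close>. Since \<open>C\<close> is compact and avoids the spectrum of
  \<open>a\<close>, it also avoids the spectra of nearby elements, so that the same segments serve for all of
  them. On segments one can differentiate under the integral sign; the curves themselves may have infinite length.
\<close>
lemma cycle_localisation:
  assumes "open V" "cycle_in \<Gamma> V"
  shows "\<exists>C L. compact C \<and> C \<subseteq> V \<and>
    (\<forall>e\<in>set L. closed_segment (fst e) (snd e) \<subseteq> C) \<and>
    (\<forall>g :: complex \<Rightarrow> 'a::complex_banach. C1_holomorphic_on g C \<longrightarrow>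
       cycle_integral \<Gamma> g = (\<Sum>e\<leftarrow>L. path_integral (linepath (fst e) (snd e)) g))"
proof -
  define T where "T = (\<Union>\<gamma>\<in>set \<Gamma>. path_image \<gamma>)"
  have "compact T" "T \<subseteq> V"
    using assms(2) by (auto simp: T_def cycle_in_def intro!: compact_UN compact_path_image valid_path_imp_path)
  then obtain \<epsilon> where "\<epsilon> > 0" and \<epsilon>: "(\<Union>x\<in>T. cball x \<epsilon>) \<subseteq> V"
    using compact_subset_open_imp_cball_epsilon_subset \<open>open V\<close> by metis
  define C where "C = (\<Union>x\<in>T. cball x \<epsilon>)"
  \<comment> \<open>Compactness: a closed neighbourhood of fixed radius is a sum of two compact sets.\<close>
  have "C = (\<Union>x\<in>T. \<Union>y\<in>cball 0 \<epsilon>. {x + y})"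
  proof (intro equalityI subsetI)
    fix w assume "w \<in> C"
    then obtain x where "x \<in> T" "dist x w \<le> \<epsilon>" by (auto simp: C_def)
    then show "w \<in> (\<Union>x\<in>T. \<Union>y\<in>cball 0 \<epsilon>. {x + y})"
      by (intro UN_I[of x] UN_I[of "w - x"]) (auto simp: dist_norm norm_minus_commute)
  next
    fix w assume "w \<in> (\<Union>x\<in>T. \<Union>y\<in>cball 0 \<epsilon>. {x + y})"
    then obtain x y where "x \<in> T" "norm y \<le> \<epsilon>" "w = x + y" by auto
    then show "w \<in> C" unfolding C_def by (intro UN_I[of x]) (auto simp: dist_norm)
  qed
  then have "compact C"
    using compact_sums'[OF \<open>compact T\<close> compact_cball[of 0 \<epsilon>]] by simp
  have ball: "ball z \<epsilon> \<subseteq> interior C" if "z \<in> T" for z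
    using that by (intro interior_maximal) (auto simp: C_def)
  have "cycle_in \<Gamma> (interior C)"
    unfolding cycle_in_def
  proof (intro ballI conjI subsetI)
    fix \<gamma> z assume "\<gamma> \<in> set \<Gamma>" "z \<in> path_image \<gamma>"
    then have "z \<in> T" by (auto simp: T_def)
    then show "z \<in> interior C" using ball[of z] \<open>\<epsilon> > 0\<close> by auto
  qed (use assms(2) in \<open>auto simp: cycle_in_def\<close>)
  moreover have "\<epsilon> / 4 > 0" using \<open>\<epsilon> > 0\<close> by simp
  moreover have "ball z (4 * (\<epsilon> / 4)) \<subseteq> interior C" if "\<gamma> \<in> set \<Gamma>" "z \<in> path_image \<gamma>" for \<gamma> z
    using ball[of z] that by (auto simp: T_def)
  ultimately have "\<exists>L. (\<forall>p q. (p, q) \<in> set L \<longrightarrow> grid_step p q \<and> path_image (edge_path (\<epsilon> / 4) (p, q)) \<subseteq> interior C)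
    \<and> mset (map fst L) = mset (map snd L)
    \<and> (\<forall>g :: complex \<Rightarrow> 'a. C1_holomorphic_on g (interior C) \<longrightarrow>
           cycle_integral \<Gamma> g = (\<Sum>e\<leftarrow>L. path_integral (edge_path (\<epsilon> / 4) e) g))"
    by (rule cycle_grid_approximation)
  then obtain L where L: "\<And>p q. (p, q) \<in> set L \<Longrightarrow> path_image (edge_path (\<epsilon> / 4) (p, q)) \<subseteq> interior C"
    "\<And>g :: complex \<Rightarrow> 'a. C1_holomorphic_on g (interior C) \<Longrightarrow>
           cycle_integral \<Gamma> g = (\<Sum>e\<leftarrow>L. path_integral (edge_path (\<epsilon> / 4) e) g)"
    by blast
  let ?L = "map (map_prod (grid_point (\<epsilon> / 4)) (grid_point (\<epsilon> / 4))) L"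
  show ?thesis
  proof (intro exI[of _ C] exI[of _ ?L] conjI ballI allI impI)
    show "closed_segment (fst e) (snd e) \<subseteq> C" if "e \<in> set ?L" for e
      using that L(1) interior_subset[of C] by (fastforce simp: path_image_edge_path)
    show "cycle_integral \<Gamma> g = (\<Sum>e\<leftarrow>?L. path_integral (linepath (fst e) (snd e)) g)"
      if "C1_holomorphic_on g C" for g :: "complex \<Rightarrow> 'a"
      using L(2)[OF C1_holomorphic_on_subset[OF that interior_subset]]
      by (simp add: o_def edge_path_def)
  qed (use \<open>compact C\<close> \<epsilon> in \<open>auto simp: C_def\<close>)
qed

lemma eventually_along_line:
  fixes a d :: "'a::complex_banach_algebra_1"
  assumes "\<forall>\<^sub>F x in nhds a. P x"
  shows "\<forall>\<^sub>F s in nhds 0. P (a + s *\<^sub>C d)"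
proof -
  let ?g = "\<lambda>s. a + s *\<^sub>C d"
  have "isCont ?g 0"
    by (intro continuous_intros scaleC.isCont)
  then have "(?g \<longlongrightarrow> ?g 0) (at 0)" by (rule isContD)
  then have "(?g \<longlongrightarrow> ?g 0) (nhds 0)"
    using tendsto_at_iff_tendsto_nhds[of ?g 0] by blast
  then have "filterlim ?g (nhds a) (nhds 0)"
    by (simp add: scaleC.zero_left)
  then show ?thesis using assms by (rule eventually_compose_filterlim[rotated])
qed

lemma path_integral_resolvent_word_deriv:
  fixes a d :: "'a::complex_banach_algebra_1"
  assumes f: "continuous_on (closed_segment p q) f" and disj: "closed_segment p q \<inter> spectrum a = {}"
  shows "((\<lambda>s. path_integral (linepath p q) (\<lambda>z. f z *\<^sub>C interleave (resolvent (a + s *\<^sub>C d) z) cs))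
     has_derivative (\<lambda>h. h *\<^sub>C path_integral (linepath p q) (\<lambda>z. f z *\<^sub>C interleave_insert (resolvent a z) d cs)))
     (at 0)"
proof -
  let ?l = "linepath p q"
  have "\<forall>\<^sub>F s in nhds 0. closed_segment p q \<inter> spectrum (a + s *\<^sub>C d) = {}"
    by (intro eventually_along_line eventually_compact_disjoint_spectrum compact_segment disj)
  then obtain r where "r > 0" and r: "\<And>s. s \<in> ball 0 r \<Longrightarrow> closed_segment p q \<inter> spectrum (a + s *\<^sub>C d) = {}"
    unfolding eventually_nhds_metric by (auto simp: dist_commute)
  have l: "?l t \<in> closed_segment p q" if "t \<in> {0..1}" for t
    using that linepath_in_path by auto
  have res: "?l t \<notin> spectrum (a + s *\<^sub>C d)" if "s \<in> ball 0 r" "t \<in> {0..1}" for s t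
    using r[OF that(1)] l[OF that(2)] by blast
  have fl: "continuous_on {0..1} (\<lambda>t. f (?l t))"
    by (rule continuous_on_compose2[OF f continuous_on_linepath]) (use l in auto)
  let ?S = "ball 0 r \<times> {0..1::real}"
  have fS: "continuous_on ?S (\<lambda>x. f (?l (snd x)))"
    by (rule continuous_on_compose2[OF fl]) (auto intro!: continuous_intros)
  have lS: "continuous_on ?S (\<lambda>x. ?l (snd x))"
    unfolding linepath_def by (intro continuous_intros)
  let ?D = "\<lambda>s t. (q - p) *\<^sub>C f (?l t) *\<^sub>C interleave_insert (resolvent (a + s *\<^sub>C d) (?l t)) d cs"
  let ?G = "\<lambda>s t. (q - p) *\<^sub>C f (?l t) *\<^sub>C interleave (resolvent (a + s *\<^sub>C d) (?l t)) cs"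
  have "((\<lambda>s. integral {0..1} (?G s)) has_derivative (\<lambda>h. h *\<^sub>C integral {0..1} (?D 0))) (at 0 within ball 0 r)"
  proof (rule has_complex_derivative_integral[where g = ?G and g' = ?D and S = "ball 0 r" and ?s0.0 = 0])
    fix s :: complex and t :: real assume st: "s \<in> ball 0 r" "t \<in> {0..1}"
    have "((\<lambda>s. interleave (resolvent (a + s *\<^sub>C d) (?l t)) cs) has_derivative
        (\<lambda>h. h *\<^sub>C interleave_insert (resolvent (a + s *\<^sub>C d) (?l t)) d cs)) (at s within ball 0 r)"
      by (rule has_derivative_at_withinI[OF has_derivative_resolvent_word_direction[OF res[OF st]]])
    then have "((\<lambda>s. (q - p) *\<^sub>C f (?l t) *\<^sub>C interleave (resolvent (a + s *\<^sub>C d) (?l t)) cs) has_derivative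
        (\<lambda>h. (q - p) *\<^sub>C f (?l t) *\<^sub>C h *\<^sub>C interleave_insert (resolvent (a + s *\<^sub>C d) (?l t)) d cs)) (at s within ball 0 r)"
      by (intro bounded_linear.has_derivative[OF scaleC.bounded_linear_right])
    then show "((\<lambda>s. ?G s t) has_derivative (\<lambda>h. h *\<^sub>C ?D s t)) (at s within ball 0 r)"
      by (rule has_derivative_eq_rhs) (simp add: fun_eq_iff scaleC_scaleC mult_ac)
  next
    fix s :: complex assume "s \<in> ball 0 r"
    then show "continuous_on {0..1} (?G s)"
      by (intro continuous_intros fl continuous_on_linepath res)
  next
    show "continuous_on ?S (\<lambda>(s, t). ?D s t)"
      unfolding case_prod_unfold
      by (intro continuous_intros fS lS res) auto
  qed (use \<open>r > 0\<close> in auto)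
  then show ?thesis
    using \<open>r > 0\<close> by (simp add: path_integral_linepath_eq at_within_open[of 0 "ball 0 r"] scaleC.zero_left)
qed

text \<open>
  The Frechet derivative with respect to the algebra element. The derivative of the integrand is written
  as a composition of bounded linear maps to make its continuity in the operator norm evident.
\<close>
lemma path_integral_resolvent_has_derivative:
  fixes a :: "'a::complex_banach_algebra_1"
  assumes f: "continuous_on (closed_segment p q) f" and disj: "closed_segment p q \<inter> spectrum a = {}"
  shows "((\<lambda>x. path_integral (linepath p q) (\<lambda>z. f z *\<^sub>C resolvent x z)) has_derivative
     (\<lambda>h. path_integral (linepath p q) (\<lambda>z. f z *\<^sub>C (resolvent a z * h * resolvent a z)))) (at a)"
proof -
  let ?l = "linepath p q"
  have "\<forall>\<^sub>F x in nhds a. closed_segment p q \<inter> spectrum x = {}"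
    by (intro eventually_compact_disjoint_spectrum compact_segment disj)
  then obtain r where "r > 0" and r: "\<And>x. x \<in> ball a r \<Longrightarrow> closed_segment p q \<inter> spectrum x = {}"
    unfolding eventually_nhds_metric by (auto simp: dist_commute)
  have l: "?l t \<in> closed_segment p q" if "t \<in> {0..1}" for t
    using that linepath_in_path by auto
  have res: "?l t \<notin> spectrum x" if "x \<in> ball a r" "t \<in> {0..1}" for x t
    using r[OF that(1)] l[OF that(2)] by blast
  have fl: "continuous_on {0..1} (\<lambda>t. f (?l t))"
    by (rule continuous_on_compose2[OF f continuous_on_linepath]) (use l in auto)
  let ?S = "ball a r \<times> {0..1::real}"
  have fS: "continuous_on ?S (\<lambda>x. f (?l (snd x)))"
    by (rule continuous_on_compose2[OF fl]) (auto intro!: continuous_intros)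
  have lS: "continuous_on ?S (\<lambda>x. ?l (snd x))"
    unfolding linepath_def by (intro continuous_intros)
  define E where "E x t = scaleC.prod_right ((q - p) * f (?l t)) o\<^sub>L
      (blinfun_mult_right (resolvent x (?l t)) o\<^sub>L blinfun_mult_left (resolvent x (?l t)))" for x :: 'a and t
  have E: "blinfun_apply (E x t) h = (q - p) *\<^sub>C f (?l t) *\<^sub>C (resolvent x (?l t) * h * resolvent x (?l t))" for x t h
    by (simp add: E_def scaleC_scaleC mult.assoc)
  have cE: "continuous_on ?S (\<lambda>(x, t). E x t)"
    unfolding E_def case_prod_unfold
    by (intro continuous_intros bounded_linear.continuous_on[OF scaleC.bounded_linear_prod_right]
        bounded_linear.continuous_on[OF bounded_linear_blinfun_mult_right]
        bounded_linear.continuous_on[OF bounded_linear_blinfun_mult_left]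
        bounded_bilinear.continuous_on[OF bounded_bilinear_blinfun_compose] fS lS res) auto
  have "((\<lambda>x. integral (cbox 0 1) (\<lambda>t. (q - p) *\<^sub>C f (?l t) *\<^sub>C resolvent x (?l t))) has_derivative
      integral (cbox 0 1) (E a)) (at a within ball a r)"
  proof (rule leibniz_rule[where U = "ball a r"])
    fix x :: 'a and t :: real assume x: "x \<in> ball a r" and "t \<in> cbox 0 1"
    then have t: "t \<in> {0..1}" by simp
    have "((\<lambda>x. ?l t *\<^sub>C 1 - x) has_derivative (\<lambda>h. - h)) (at x)"
      by (auto intro!: derivative_eq_intros)
    from has_derivative_compose[OF this has_derivative_inv_of]
    have "((\<lambda>x. resolvent x (?l t)) has_derivative (\<lambda>h. resolvent x (?l t) * h * resolvent x (?l t))) (at x)"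
      using res[OF x t] by (simp add: resolvent_eq notin_spectrum)
    then have "((\<lambda>x. resolvent x (?l t)) has_derivative (\<lambda>h. resolvent x (?l t) * h * resolvent x (?l t))) (at x within ball a r)"
      by (rule has_derivative_at_withinI)
    then show "((\<lambda>x. (q - p) *\<^sub>C f (?l t) *\<^sub>C resolvent x (?l t)) has_derivative blinfun_apply (E x t)) (at x within ball a r)"
      unfolding E by (intro bounded_linear.has_derivative[OF scaleC.bounded_linear_right])
  next
    fix x assume "x \<in> ball a r"
    then have "continuous_on {0..1} (\<lambda>t. (q - p) *\<^sub>C f (?l t) *\<^sub>C resolvent x (?l t))"
      by (intro continuous_intros fl continuous_on_linepath res)
    then show "(\<lambda>t. (q - p) *\<^sub>C f (?l t) *\<^sub>C resolvent x (?l t)) integrable_on cbox 0 1"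
      by (simp add: integrable_continuous_real)
  qed (use \<open>r > 0\<close> cE in auto)
  moreover have "blinfun_apply (integral {0..1} (E a)) =
      (\<lambda>h. path_integral ?l (\<lambda>z. f z *\<^sub>C (resolvent a z * h * resolvent a z)))"
  proof
    fix h
    have "continuous_on {0..1} ((\<lambda>(x, t). E x t) \<circ> (\<lambda>t. (a, t)))"
      using \<open>r > 0\<close> by (intro continuous_on_compose continuous_intros continuous_on_subset[OF cE]) auto
    then have "E a integrable_on {0..1}"
      by (intro integrable_continuous_real) (simp add: o_def)
    from blinfun_apply_integral[OF this, of h]
    show "blinfun_apply (integral {0..1} (E a)) h =
        path_integral ?l (\<lambda>z. f z *\<^sub>C (resolvent a z * h * resolvent a z))"
      by (simp add: path_integral_linepath_eq E)
  qed
  ultimately show ?thesis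
    using \<open>r > 0\<close> by (simp add: path_integral_linepath_eq at_within_open[of a "ball a r"])
qed

text \<open>
  The points off the curves around which each curve winds as often as around some point of the spectrum of \<open>a\<close> form
  an open set that contains this spectrum, hence also the spectra of nearby elements.
\<close>
lemma eventually_surrounds:
  fixes a :: "'a::complex_banach_algebra_1"
  assumes "open U" and \<Gamma>: "surrounds_in \<Gamma> (spectrum a) U"
  shows "\<forall>\<^sub>F x in nhds a. surrounds_in \<Gamma> (spectrum x) U"
proof -
  \<comment> \<open>Level sets of the individual winding numbers are open because these are locally constant.\<close>
  define N where "N z0 = (\<Inter>\<gamma>\<in>set \<Gamma>. {z. z \<notin> path_image \<gamma> \<and> winding_number \<gamma> z = winding_number \<gamma> z0})" for z0
  define N' where "N' = U \<inter> (\<Union>z0\<in>spectrum a. N z0)"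
  have "open (N z0)" for z0
    using \<Gamma> unfolding N_def surrounds_in_def cycle_in_def
    by (intro open_INT ballI open_winding_number_levelsets) (auto intro: valid_path_imp_path)
  then have "open N'" using \<open>open U\<close> by (auto simp: N'_def)
  moreover have "spectrum a \<subseteq> N'"
    using \<Gamma> by (fastforce simp: N'_def N_def surrounds_in_def)
  ultimately have "\<forall>\<^sub>F x in nhds a. spectrum x \<subseteq> N'"
    by (rule eventually_spectrum_subset)
  then show ?thesis
  proof eventually_elim
    case (elim x)
    have "cycle_winding_number \<Gamma> z = 1 \<and> (\<forall>\<gamma>\<in>set \<Gamma>. z \<notin> path_image \<gamma>)" if "z \<in> spectrum x" for z
    proof -
      obtain z0 where z0: "z0 \<in> spectrum a" "z \<in> N z0" using \<open>z \<in> spectrum x\<close> elim unfolding N'_def by blast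
      have "cycle_winding_number \<Gamma> z = cycle_winding_number \<Gamma> z0"
        unfolding cycle_winding_number_def using z0(2)
        by (intro arg_cong[where f = sum_list] map_cong) (auto simp: N_def)
      then show ?thesis using \<Gamma> z0 by (auto simp: surrounds_in_def N_def)
    qed
    then show ?case
      using \<Gamma> elim by (auto simp: surrounds_in_def N'_def)
  qed
qed

lemma surrounds_in_imp_cycle_in_resolvent_set:
  "surrounds_in \<Gamma> S U \<Longrightarrow> cycle_in \<Gamma> (U - S)"
  by (auto simp: surrounds_in_def cycle_in_def)

text \<open>
  Two cycles that surround the spectrum have equal winding numbers around all points outside
  \<open>U - spectrum a\<close>, namely one on the spectrum and zero off \<open>U\<close>. So their integrals agree, and
  the value in the definition of the calculus is well determined.
\<close>
lemma holomorphic_calculus_eq: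
  fixes a :: "'a::complex_banach_algebra_1"
  assumes U: "open U" and f: "f holomorphic_on U" and \<Gamma>: "surrounds_in \<Gamma> (spectrum a) U"
  shows "holomorphic_calculus U f a =
    (1 / (2 * of_real pi * \<i>)) *\<^sub>C cycle_integral \<Gamma> (\<lambda>z. f z *\<^sub>C resolvent a z)"
proof -
  have "C1_holomorphic_on (\<lambda>z. f z *\<^sub>C interleave (resolvent a z) []) (U - spectrum a)"
    by (rule C1_holomorphic_on_resolvent_word[OF U f]) auto
  then have g: "C1_holomorphic_on (\<lambda>z. f z *\<^sub>C resolvent a z) (U - spectrum a)" by simp
  have indep: "cycle_integral \<Gamma> (\<lambda>z. f z *\<^sub>C resolvent a z) = cycle_integral \<Gamma>' (\<lambda>z. f z *\<^sub>C resolvent a z)"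
    if "surrounds_in \<Gamma>' (spectrum a) U" for \<Gamma>'
  proof (rule homologous_cycles_integral_eq[OF _ _ _ _ g])
    show "open (U - spectrum a)" using U closed_spectrum by (rule open_Diff)
    show "cycle_winding_number \<Gamma> z = cycle_winding_number \<Gamma>' z" if "z \<notin> U - spectrum a" for z
      using \<Gamma> \<open>surrounds_in \<Gamma>' (spectrum a) U\<close> that by (auto simp: surrounds_in_def)
  qed (use \<Gamma> that surrounds_in_imp_cycle_in_resolvent_set in blast)+
  show ?thesis
    unfolding holomorphic_calculus_def
  proof (rule the_equality; (intro allI impI)?)
    fix \<Gamma>' assume "surrounds_in \<Gamma>' (spectrum a) U"
    then show "(1 / (2 * of_real pi * \<i>)) *\<^sub>C cycle_integral \<Gamma> (\<lambda>z. f z *\<^sub>C resolvent a z) =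
        (1 / (2 * of_real pi * \<i>)) *\<^sub>C cycle_integral \<Gamma>' (\<lambda>z. f z *\<^sub>C resolvent a z)"
      by (rule arg_cong[OF indep])
  next
    fix v
    assume "\<forall>\<Gamma>'. surrounds_in \<Gamma>' (spectrum a) U \<longrightarrow>
        v = (1 / (2 * of_real pi * \<i>)) *\<^sub>C cycle_integral \<Gamma>' (\<lambda>z. f z *\<^sub>C resolvent a z)"
    then have "surrounds_in \<Gamma> (spectrum a) U \<longrightarrow>
        v = (1 / (2 * of_real pi * \<i>)) *\<^sub>C cycle_integral \<Gamma> (\<lambda>z. f z *\<^sub>C resolvent a z)"
      by (rule spec)
    then show "v = (1 / (2 * of_real pi * \<i>)) *\<^sub>C cycle_integral \<Gamma> (\<lambda>z. f z *\<^sub>C resolvent a z)"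
      using \<Gamma> by (rule mp)
  qed
qed

lemma cycle_integral_resolvent_word_deriv:
  fixes a d :: "'a::complex_banach_algebra_1"
  assumes U: "open U" and f: "f holomorphic_on U" and \<Gamma>: "cycle_in \<Gamma> (U - spectrum a)"
  shows "((\<lambda>s. cycle_integral \<Gamma> (\<lambda>z. f z *\<^sub>C interleave (resolvent (a + s *\<^sub>C d) z) cs)) has_derivative
     (\<lambda>h. h *\<^sub>C (\<Sum>ys\<leftarrow>inserts d cs. cycle_integral \<Gamma> (\<lambda>z. f z *\<^sub>C interleave (resolvent a z) ys)))) (at 0)"
proof -
  obtain C L where C: "compact C" "C \<subseteq> U - spectrum a"
    and seg: "\<And>e. e \<in> set L \<Longrightarrow> closed_segment (fst e) (snd e) \<subseteq> C"
    and L: "\<And>g :: complex \<Rightarrow> 'a. C1_holomorphic_on g C \<Longrightarrow>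
           cycle_integral \<Gamma> g = (\<Sum>e\<leftarrow>L. path_integral (linepath (fst e) (snd e)) g)"
    using cycle_localisation[where 'a = 'a, OF open_Diff[OF U closed_spectrum] \<Gamma>] by blast
  have onL: "cycle_integral \<Gamma> (\<lambda>z. f z *\<^sub>C interleave (resolvent x z) ys) =
      (\<Sum>e\<leftarrow>L. path_integral (linepath (fst e) (snd e)) (\<lambda>z. f z *\<^sub>C interleave (resolvent x z) ys))"
    if "C \<inter> spectrum x = {}" for x :: 'a and ys
    using C(2) that by (intro L C1_holomorphic_on_resolvent_word[OF U f]) auto
  have contf: "continuous_on (closed_segment (fst e) (snd e)) f" if "e \<in> set L" for e
    using holomorphic_on_imp_continuous_on[OF f] seg[OF that] C(2) by (blast intro: continuous_on_subset)
  have disj: "closed_segment (fst e) (snd e) \<inter> spectrum a = {}" if "e \<in> set L" for e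
    using seg[OF that] C(2) by blast
  have ev: "\<forall>\<^sub>F s in nhds 0. C \<inter> spectrum (a + s *\<^sub>C d) = {}"
    using C by (intro eventually_along_line eventually_compact_disjoint_spectrum) auto
  have "((\<lambda>s. \<Sum>e\<leftarrow>L. path_integral (linepath (fst e) (snd e)) (\<lambda>z. f z *\<^sub>C interleave (resolvent (a + s *\<^sub>C d) z) cs))
      has_derivative (\<lambda>h. \<Sum>e\<leftarrow>L. h *\<^sub>C path_integral (linepath (fst e) (snd e))
         (\<lambda>z. f z *\<^sub>C interleave_insert (resolvent a z) d cs))) (at 0)"
    by (intro has_derivative_sum_list path_integral_resolvent_word_deriv contf disj)
  then have "((\<lambda>s. cycle_integral \<Gamma> (\<lambda>z. f z *\<^sub>C interleave (resolvent (a + s *\<^sub>C d) z) cs))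
      has_derivative (\<lambda>h. \<Sum>e\<leftarrow>L. h *\<^sub>C path_integral (linepath (fst e) (snd e))
         (\<lambda>z. f z *\<^sub>C interleave_insert (resolvent a z) d cs))) (at 0)"
  proof (rule has_derivative_transform_eventually)
    show "\<forall>\<^sub>F s in at 0. (\<Sum>e\<leftarrow>L. path_integral (linepath (fst e) (snd e)) (\<lambda>z. f z *\<^sub>C interleave (resolvent (a + s *\<^sub>C d) z) cs))
        = cycle_integral \<Gamma> (\<lambda>z. f z *\<^sub>C interleave (resolvent (a + s *\<^sub>C d) z) cs)"
      using ev unfolding eventually_at_filter by eventually_elim (simp add: onL)
    show "(\<Sum>e\<leftarrow>L. path_integral (linepath (fst e) (snd e)) (\<lambda>z. f z *\<^sub>C interleave (resolvent (a + 0 *\<^sub>C d) z) cs))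
        = cycle_integral \<Gamma> (\<lambda>z. f z *\<^sub>C interleave (resolvent (a + 0 *\<^sub>C d) z) cs)"
      using eventually_nhds_x_imp_x[OF ev] by (simp add: onL)
  qed simp
  moreover have "(\<Sum>e\<leftarrow>L. path_integral (linepath (fst e) (snd e)) (\<lambda>z. f z *\<^sub>C interleave_insert (resolvent a z) d cs))
     = (\<Sum>ys\<leftarrow>inserts d cs. cycle_integral \<Gamma> (\<lambda>z. f z *\<^sub>C interleave (resolvent a z) ys))"
  proof -
    have "path_integral (linepath (fst e) (snd e)) (\<lambda>z. f z *\<^sub>C interleave_insert (resolvent a z) d cs)
       = (\<Sum>ys\<leftarrow>inserts d cs. path_integral (linepath (fst e) (snd e)) (\<lambda>z. f z *\<^sub>C interleave (resolvent a z) ys))"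
      if "e \<in> set L" for e
      unfolding interleave_insert_def scaleC_sum_list
      using disj[OF that]
      by (intro path_integral_linepath_sum_list continuous_intros contf that) auto
    then have "(\<Sum>e\<leftarrow>L. path_integral (linepath (fst e) (snd e)) (\<lambda>z. f z *\<^sub>C interleave_insert (resolvent a z) d cs))
       = (\<Sum>e\<leftarrow>L. \<Sum>ys\<leftarrow>inserts d cs. path_integral (linepath (fst e) (snd e)) (\<lambda>z. f z *\<^sub>C interleave (resolvent a z) ys))"
      by (intro arg_cong[where f = sum_list] map_cong) auto
    also have "\<dots> = (\<Sum>ys\<leftarrow>inserts d cs. cycle_integral \<Gamma> (\<lambda>z. f z *\<^sub>C interleave (resolvent a z) ys))"
    proof -
      have "C \<inter> spectrum a = {}" using C(2) by blast
      then show ?thesis by (subst sum_list_swap) (simp add: onL)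
    qed
    finally show ?thesis .
  qed
  ultimately show ?thesis by (simp flip: scaleC_sum_list)
qed

text \<open>
  Induction on the order. In the step, \<open>\<Gamma>\<close> still surrounds the spectrum at all points near \<open>a\<close> on the line in
  direction \<open>b (Suc k)\<close>, so the formula of order \<open>k\<close> holds there with the same cycle and can be
  differentiated.
\<close>
lemma holomorphic_calculus_has_directional_derivs:
  fixes a :: "'a::complex_banach_algebra_1"
  assumes U: "open U" and f: "f holomorphic_on U" and \<Gamma>: "surrounds_in \<Gamma> (spectrum a) U"
  shows "has_directional_derivs (holomorphic_calculus U f) b k a
     ((1 / (2 * of_real pi * \<i>)) *\<^sub>C (\<Sum>xs\<in>permutations_of_set {1..k}.
        cycle_integral \<Gamma> (\<lambda>z. f z *\<^sub>C interleave (resolvent a z) (map b xs))))"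
  using \<Gamma>
proof (induction k arbitrary: a)
  case 0
  then show ?case by (simp add: holomorphic_calculus_eq[OF U f])
next
  case (Suc k)
  let ?c = "1 / (2 * of_real pi * \<i>) :: complex" and ?d = "b (Suc k)"
  define W where "W x xs = cycle_integral \<Gamma> (\<lambda>z. f z *\<^sub>C interleave (resolvent x z) xs)" for x :: 'a and xs
  define G where "G s = ?c *\<^sub>C (\<Sum>xs\<in>permutations_of_set {1..k}. W (a + s *\<^sub>C ?d) (map b xs))" for s
  have "\<forall>\<^sub>F s in nhds 0. surrounds_in \<Gamma> (spectrum (a + s *\<^sub>C ?d)) U"
    by (intro eventually_along_line eventually_surrounds U Suc.prems)
  then have "\<forall>\<^sub>F s in nhds 0. has_directional_derivs (holomorphic_calculus U f) b k (a + s *\<^sub>C ?d) (G s)"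
    unfolding G_def W_def by eventually_elim (rule Suc.IH)
  moreover have "(G has_derivative (\<lambda>s. s *\<^sub>C ?c *\<^sub>C (\<Sum>xs\<in>permutations_of_set {1..Suc k}. W a (map b xs)))) (at 0)"
  proof -
    define X where "X xs = (\<Sum>ys\<leftarrow>inserts ?d (map b xs). W a ys)" for xs
    have "X xs = (\<Sum>ys\<leftarrow>inserts (Suc k) xs. W a (map b ys))" for xs
      unfolding X_def map_inserts[of b "Suc k" xs, symmetric] by (simp add: o_def)
    then have Y: "(\<Sum>xs\<in>permutations_of_set {1..Suc k}. W a (map b xs)) = (\<Sum>xs\<in>permutations_of_set {1..k}. X xs)"
      by (simp only: sum_permutations_Suc)
    have "(G has_derivative (\<lambda>h. ?c *\<^sub>C (\<Sum>xs\<in>permutations_of_set {1..k}. h *\<^sub>C X xs))) (at 0)"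
      unfolding G_def W_def X_def
      by (intro bounded_linear.has_derivative[OF scaleC.bounded_linear_right] has_derivative_sum
          cycle_integral_resolvent_word_deriv[OF U f] surrounds_in_imp_cycle_in_resolvent_set Suc.prems)
    then show ?thesis
    proof (rule has_derivative_eq_rhs)
      show "(\<lambda>h. ?c *\<^sub>C (\<Sum>xs\<in>permutations_of_set {1..k}. h *\<^sub>C X xs)) =
          (\<lambda>s. s *\<^sub>C ?c *\<^sub>C (\<Sum>xs\<in>permutations_of_set {1..Suc k}. W a (map b xs)))"
        unfolding Y scaleC.sum_right[symmetric] by (rule ext) (rule scaleC_left_commute)
    qed
  qed
  ultimately show ?case unfolding W_def has_directional_derivs.simps by blast
qed

text \<open>
  The surrounding cycle constructed above is what turns the definite description into an integral at every
  point. Near \<open>a\<close> the calculus is a finite sum of integrals over fixed segments.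
\<close>
lemma holomorphic_calculus_holomorphic:
  assumes U: "open U" and f: "f holomorphic_on U"
  shows "holomorphic_map_on (holomorphic_calculus U f) (spectrum_in U :: 'a::complex_banach_algebra_1 set)"
  unfolding holomorphic_map_on_def
proof (intro conjI ballI)
  show "open (spectrum_in U :: 'a set)" by (rule open_spectrum_in[OF U])
  fix a :: 'a assume "a \<in> spectrum_in U"
  then have "spectrum a \<subseteq> U" by (simp add: spectrum_in_def)
  then obtain \<Gamma> where \<Gamma>: "surrounds_in \<Gamma> (spectrum a) U"
    using surrounding_cycle_exists[OF compact_spectrum U] by blast
  obtain C L where C: "compact C" "C \<subseteq> U - spectrum a"
    and seg: "\<And>e. e \<in> set L \<Longrightarrow> closed_segment (fst e) (snd e) \<subseteq> C"
    and L: "\<And>g :: complex \<Rightarrow> 'a. C1_holomorphic_on g C \<Longrightarrow>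
           cycle_integral \<Gamma> g = (\<Sum>e\<leftarrow>L. path_integral (linepath (fst e) (snd e)) g)"
    using cycle_localisation[where 'a = 'a, OF open_Diff[OF U closed_spectrum] surrounds_in_imp_cycle_in_resolvent_set[OF \<Gamma>]] by blast
  let ?c = "1 / (2 * of_real pi * \<i>) :: complex"
  define F where "F x = ?c *\<^sub>C (\<Sum>e\<leftarrow>L. path_integral (linepath (fst e) (snd e)) (\<lambda>z. f z *\<^sub>C resolvent x z))" for x :: 'a
  define D where "D h = ?c *\<^sub>C (\<Sum>e\<leftarrow>L. path_integral (linepath (fst e) (snd e))
      (\<lambda>z. f z *\<^sub>C (resolvent a z * h * resolvent a z)))" for h
  have contf: "continuous_on (closed_segment (fst e) (snd e)) f" if "e \<in> set L" for e
    using holomorphic_on_imp_continuous_on[OF f] seg[OF that] C(2) by (blast intro: continuous_on_subset)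
  have disj: "closed_segment (fst e) (snd e) \<inter> spectrum a = {}" if "e \<in> set L" for e
    using seg[OF that] C(2) by blast
  have F_deriv: "(F has_derivative D) (at a)"
    unfolding F_def D_def
    by (intro bounded_linear.has_derivative[OF scaleC.bounded_linear_right] has_derivative_sum_list
        path_integral_resolvent_has_derivative contf disj)
  have ev: "\<forall>\<^sub>F x in nhds a. F x = holomorphic_calculus U f x"
  proof -
    have "\<forall>\<^sub>F x in nhds a. C \<inter> spectrum x = {}"
      using C by (intro eventually_compact_disjoint_spectrum) auto
    then show ?thesis
      using eventually_surrounds[OF U \<Gamma>]
    proof eventually_elim
      case (elim x)
      have "C1_holomorphic_on (\<lambda>z. f z *\<^sub>C interleave (resolvent x z) []) C"
        using C(2) elim(1) by (intro C1_holomorphic_on_resolvent_word[OF U f]) auto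
      then show ?case using L holomorphic_calculus_eq[OF U f elim(2)] by (simp add: F_def)
    qed
  qed
  have "(holomorphic_calculus U f has_derivative D) (at a)"
  proof (rule has_derivative_transform_eventually[OF F_deriv])
    show "\<forall>\<^sub>F x in at a. F x = holomorphic_calculus U f x" "F a = holomorphic_calculus U f a"
      using ev unfolding eventually_nhds_conv_at by blast+
  qed simp
  moreover have "D (c *\<^sub>C h) = c *\<^sub>C D h" for c h
  proof -
    have "path_integral (linepath (fst e) (snd e)) (\<lambda>z. f z *\<^sub>C (resolvent a z * (c *\<^sub>C h) * resolvent a z))
       = c *\<^sub>C path_integral (linepath (fst e) (snd e)) (\<lambda>z. f z *\<^sub>C (resolvent a z * h * resolvent a z))"
      if "e \<in> set L" for e
    proof -
      have "continuous_on (closed_segment (fst e) (snd e)) (\<lambda>z. f z *\<^sub>C (resolvent a z * h * resolvent a z))"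
        using disj[OF that] by (intro continuous_intros contf that) auto
      from path_integral_linepath_scaleC[OF this, of c] show ?thesis
        by (simp add: mult_scaleC_left mult_scaleC_right scaleC_left_commute[of c])
    qed
    then have "(\<Sum>e\<leftarrow>L. path_integral (linepath (fst e) (snd e)) (\<lambda>z. f z *\<^sub>C (resolvent a z * (c *\<^sub>C h) * resolvent a z)))
       = c *\<^sub>C (\<Sum>e\<leftarrow>L. path_integral (linepath (fst e) (snd e)) (\<lambda>z. f z *\<^sub>C (resolvent a z * h * resolvent a z)))"
      unfolding scaleC_sum_list by (intro arg_cong[where f = sum_list] map_cong) auto
    then show ?thesis by (simp add: D_def scaleC_left_commute)
  qed
  ultimately show "\<exists>D. (holomorphic_calculus U f has_derivative D) (at a) \<and> (\<forall>c x. D (c *\<^sub>C x) = c *\<^sub>C D x)"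
    by blast
qed

theorem theorem1p3:
  fixes U :: "complex set" and f :: "complex \<Rightarrow> complex"
  assumes "open U" and "f holomorphic_on U"
  shows "holomorphic_map_on (holomorphic_calculus U f)
           (spectrum_in U :: 'a::complex_banach_algebra_1 set) \<and>
         (\<forall>(k::nat) (a::'a) \<Gamma> (b :: nat \<Rightarrow> 'a).
            a \<in> spectrum_in U \<longrightarrow> surrounds_in \<Gamma> (spectrum a) U \<longrightarrow>
            has_directional_derivs (holomorphic_calculus U f) b k a
              ((1 / (2 * of_real pi * \<i>)) *\<^sub>C
                 (\<Sum>\<pi> | \<pi> permutes {1..k}.
                    cycle_integral \<Gamma>
                      (\<lambda>z. f z *\<^sub>C
                         (prod_list (map (\<lambda>j. resolvent a z * b (\<pi> j)) [1..<Suc k])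
                          * resolvent a z)))))"
proof (intro conjI allI impI)
  fix k \<Gamma> and a :: 'a and b :: "nat \<Rightarrow> 'a" assume \<Gamma>: "surrounds_in \<Gamma> (spectrum a) U"
  have "interleave (resolvent a z) (map b (map \<pi> [1..<Suc k])) =
      prod_list (map (\<lambda>j. resolvent a z * b (\<pi> j)) [1..<Suc k]) * resolvent a z" for z \<pi>
    using prod_list_eq_interleave[of "resolvent a z" "b \<circ> \<pi>" "[1..<Suc k]"] by (simp only: map_map o_def)
  then show "has_directional_derivs (holomorphic_calculus U f) b k a
      ((1 / (2 * of_real pi * \<i>)) *\<^sub>C (\<Sum>\<pi> | \<pi> permutes {1..k}. cycle_integral \<Gamma>
         (\<lambda>z. f z *\<^sub>C (prod_list (map (\<lambda>j. resolvent a z * b (\<pi> j)) [1..<Suc k]) * resolvent a z))))"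
    using holomorphic_calculus_has_directional_derivs[OF assms \<Gamma>, of b k]
      sum_permutes_eq_sum_permutations_of_set[of
        "\<lambda>xs. cycle_integral \<Gamma> (\<lambda>z. f z *\<^sub>C interleave (resolvent a z) (map b xs))" k]
    by (simp only:)
qed (rule holomorphic_calculus_holomorphic[OF assms])

end
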